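(* Let $(F^4,g)$ and the orthonormal frame $\{e_1,e_2,e_3,e_4\}$ be as described in the context, with global coordinates $(x,y,s,t)$, $t>0$. Let $X=X_1(s,t)e_1+X_2(s,t)e_2+X_3(s,t)e_3+X_4(s,t)e_4$ be a smooth vector field on $F^4$ whose components depend only on $s$ and $t$. Then $X$ is a harmonic map from $(F^4,g)$ to $(TF^4,g^S)$, where $g^S$ is the Sasaki metric, if and only if $X_i(s,t)=0$ identically for all $i=1,\dots,4$.
   Context: $F^4=\mathbb{R}^2\times\mathbb{H}^2$ with global coordinates $(x,y,s,t)$, where $(x,y)\in\mathbb{R}^2$ and $(s,t)$, $t>0$, are upper half-plane coordinates on $\mathbb{H}^2$. The frame $$e_1=\sqrt t\,\partial_x,\quad e_2=\tfrac{s}{\sqrt t}\partial_x+\tfrac{1}{\sqrt t}\partial_y,\quad e_3=2t\,\partial_s,\quad e_4=2t\,\partial_t$$ is declared orthonormal, which defines the Riemannian metric $g$; $\nabla$ denotes its Levi-Civita connection and $R(X,Y)Z=\nabla_X\nabla_YZ-\nabla_Y\nabla_XZ-\nabla_{[X,Y]}Z$ its curvature. The Sasaki metric $g^S$ on the tangent bundle $\pi\colon TF^4\to F^4$ is defined by $g^S(X^h,Y^h)=g^S(X^v,Y^v)=g(X,Y)\circ\pi$ and $g^S(X^h,Y^v)=0$, with $X^h,X^v$ the horizontal and vertical lifts. A map between Riemannian manifolds is harmonic if its tension field vanishes. For a vector field regarded as a map $X\colon(F^4,g)\to(TF^4,g^S)$ the tension field is $\tau(X)=\big(\mathrm{Tr}_gR(X,\nabla_{\cdot}X)\cdot\big)^h+\big(\mathrm{Tr}_g\nabla^2X\big)^v$,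 so $X$ is a harmonic map if and only if $$\sum_{i=1}^4R(X,\nabla_{e_i}X)e_i=0\quad\text{and}\quad\sum_{i=1}^4\big[\nabla_{e_i}\nabla_{e_i}X-\nabla_{\nabla_{e_i}e_i}X\big]=0.$$ *)

theory Defs
  imports "HOL-Analysis.Analysis"
begin

section \<open>Riemannian geometry in a global chart\<close>

text \<open>
  All manifolds here are open subsets of a Euclidean space, so a tangent vector is a vector of
  the ambient space, and a metric \<open>g\<close> assigns to each point \<open>p\<close> a bilinear form \<open>g p\<close>.
  Functions are total; only their values on the open set in question matter.
\<close>

type_synonym 'a metric_field = "'a \<Rightarrow> 'a \<Rightarrow> 'a \<Rightarrow> real"

primrec Ck_on :: "nat \<Rightarrow> 'a::real_normed_vector set \<Rightarrow> ('a \<Rightarrow> 'b::real_normed_vector) \<Rightarrow> bool" where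
  "Ck_on 0 S f \<longleftrightarrow> continuous_on S f"
| "Ck_on (Suc k) S f \<longleftrightarrow> (\<forall>p\<in>S. f differentiable (at p)) \<and>
     (\<forall>v. Ck_on k S (\<lambda>p. frechet_derivative f (at p) v))"

text \<open>Meant for open \<open>S\<close> only, because the derivatives are full derivatives.\<close>

definition smooth_on :: "'a::real_normed_vector set \<Rightarrow> ('a \<Rightarrow> 'b::real_normed_vector) \<Rightarrow> bool" where
  "smooth_on S f \<longleftrightarrow> (\<forall>k. Ck_on k S f)"

text \<open>
  \<open>koszul g p u v z\<close> is \<open>2 g(\<nabla>\<^sub>u v, z)\<close> for the constant (coordinate) vector fields \<open>u, v, z\<close>,
  whose brackets vanish; \<open>christoffel g p u v\<close> is the value of \<open>\<nabla>\<^sub>u v\<close> at \<open>p\<close>, that is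
  \<open>\<Gamma>\<^sup>k\<^sub>i\<^sub>j u\<^sup>i v\<^sup>j \<partial>\<^sub>k\<close>.
\<close>

definition koszul :: "'a::euclidean_space metric_field \<Rightarrow> 'a \<Rightarrow> 'a \<Rightarrow> 'a \<Rightarrow> 'a \<Rightarrow> real" where
  "koszul g p u v z =
     frechet_derivative (\<lambda>q. g q v z) (at p) u
   + frechet_derivative (\<lambda>q. g q u z) (at p) v
   - frechet_derivative (\<lambda>q. g q u v) (at p) z"

definition christoffel :: "'a::euclidean_space metric_field \<Rightarrow> 'a \<Rightarrow> 'a \<Rightarrow> 'a \<Rightarrow> 'a" where
  "christoffel g p u v = (THE w. \<forall>z. 2 * g p w z = koszul g p u v z)"

text \<open>
  The \<open>g\<close>-gradient of the linear form \<open>\<lambda>z. b \<bullet> z\<close>. For \<open>b\<close> the \<open>i\<close>-th coordinate vector it is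
  \<open>g\<^sup>i\<^sup>j \<partial>\<^sub>j\<close>, so that \<open>metric_trace\<close> is \<open>g\<^sup>i\<^sup>j B\<^sub>i\<^sub>j\<close>.
\<close>

definition sharp :: "'a::euclidean_space metric_field \<Rightarrow> 'a \<Rightarrow> 'a \<Rightarrow> 'a" where
  "sharp g p b = (THE w. \<forall>z. g p w z = b \<bullet> z)"

definition metric_trace ::
    "'a::euclidean_space metric_field \<Rightarrow> 'a \<Rightarrow> ('a \<Rightarrow> 'a \<Rightarrow> 'b::real_vector) \<Rightarrow> 'b" where
  "metric_trace g p B = (\<Sum>b\<in>Basis. B b (sharp g p b))"

text \<open>The second fundamental form \<open>\<nabla>d\<phi>\<close> of a map \<open>\<phi>\<close> from \<open>(U, g)\<close> to \<open>(V, h)\<close>.\<close>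

definition second_fundamental_form ::
    "'a::euclidean_space metric_field \<Rightarrow> 'b::euclidean_space metric_field \<Rightarrow> ('a \<Rightarrow> 'b) \<Rightarrow>
     'a \<Rightarrow> 'a \<Rightarrow> 'a \<Rightarrow> 'b" where
  "second_fundamental_form g h \<phi> p u v =
     frechet_derivative (\<lambda>q. frechet_derivative \<phi> (at q) v) (at p) u
   - frechet_derivative \<phi> (at p) (christoffel g p u v)
   + christoffel h (\<phi> p) (frechet_derivative \<phi> (at p) u) (frechet_derivative \<phi> (at p) v)"

definition tension_field ::
    "'a::euclidean_space metric_field \<Rightarrow> 'b::euclidean_space metric_field \<Rightarrow> ('a \<Rightarrow> 'b) \<Rightarrow>
     'a \<Rightarrow> 'b" where
  "tension_field g h \<phi> p = metric_trace g p (second_fundamental_form g h \<phi> p)"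

text \<open>Meaningful for \<open>\<phi>\<close> smooth on the open set \<open>U\<close>.\<close>

definition harmonic_map_on ::
    "'a::euclidean_space set \<Rightarrow> 'a metric_field \<Rightarrow> 'b::euclidean_space metric_field \<Rightarrow>
     ('a \<Rightarrow> 'b) \<Rightarrow> bool" where
  "harmonic_map_on U g h \<phi> \<longleftrightarrow> (\<forall>p\<in>U. tension_field g h \<phi> p = 0)"


section \<open>The Sasaki metric\<close>

text \<open>
  The tangent bundle of \<open>U\<close> is \<open>U \<times> UNIV\<close>, with points \<open>(p, v)\<close>. In the induced coordinates the
  horizontal lift of \<open>u\<^sup>i \<partial>\<^sub>i\<close> is \<open>u\<^sup>i \<partial>/\<partial>x\<^sup>i - \<Gamma>\<^sup>k\<^sub>i\<^sub>j u\<^sup>i v\<^sup>j \<partial>/\<partial>v\<^sup>k\<close>.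
\<close>

definition horizontal_lift ::
    "'a::euclidean_space metric_field \<Rightarrow> 'a \<times> 'a \<Rightarrow> 'a \<Rightarrow> 'a \<times> 'a" where
  "horizontal_lift g P u = (u, - christoffel g (fst P) u (snd P))"

definition vertical_lift :: "'a::euclidean_space \<times> 'a \<Rightarrow> 'a \<Rightarrow> 'a \<times> 'a" where
  "vertical_lift P u = (0, u)"

definition is_sasaki_form ::
    "'a::euclidean_space metric_field \<Rightarrow> 'a \<times> 'a \<Rightarrow> ('a \<times> 'a \<Rightarrow> 'a \<times> 'a \<Rightarrow> real) \<Rightarrow> bool" where
  "is_sasaki_form g P B \<longleftrightarrow> bilinear B \<and> (\<forall>V W. B V W = B W V) \<and>
     (\<forall>u w. B (horizontal_lift g P u) (horizontal_lift g P w) = g (fst P) u w \<and>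
            B (vertical_lift P u) (vertical_lift P w) = g (fst P) u w \<and>
            B (horizontal_lift g P u) (vertical_lift P w) = 0)"

definition sasaki_metric :: "'a::euclidean_space metric_field \<Rightarrow> ('a \<times> 'a) metric_field" where
  "sasaki_metric g P = (THE B. is_sasaki_form g P B)"


section \<open>The space \<open>F\<^sup>4\<close>\<close>

text \<open>The coordinates \<open>x, y, s, t\<close> of \<open>p\<close> are \<open>p $ 1, p $ 2, p $ 3, p $ 4\<close>.\<close>

definition F4 :: "(real^4) set" where
  "F4 = {p. p $ 4 > 0}"

definition F4_frame :: "4 \<Rightarrow> real^4 \<Rightarrow> real^4" where
  "F4_frame i p = (let s = p $ 3; t = p $ 4 in
     if i = 1 then sqrt t *\<^sub>R axis 1 1
     else if i = 2 then (s / sqrt t) *\<^sub>R axis 1 1 + (1 / sqrt t) *\<^sub>R axis 2 1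
     else if i = 3 then (2 * t) *\<^sub>R axis 3 1
     else (2 * t) *\<^sub>R axis 4 1)"

definition F4_metric :: "(real^4) metric_field" where
  "F4_metric p = (THE B. bilinear B \<and>
     (\<forall>i j. B (F4_frame i p) (F4_frame j p) = (if i = j then 1 else 0)))"


section \<open>The definite descriptions are well defined\<close>

lemma riesz_bilinear:
  fixes B :: "'a::euclidean_space \<Rightarrow> 'a \<Rightarrow> real"
  assumes B: "bilinear B" and pos: "\<And>u. u \<noteq> 0 \<Longrightarrow> B u u > 0" and L: "linear L"
  shows "\<exists>!w. \<forall>z. B w z = L z"
proof -
  define T where "T w = (\<Sum>b\<in>Basis. B w b *\<^sub>R b)" for w
  have linB: "linear (\<lambda>w. B w z)" "linear (B w)" for w z
    using B by (auto simp: bilinear_def)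
  have TB: "T w \<bullet> z = B w z" for w z
  proof -
    have "B w z = B w (\<Sum>b\<in>Basis. (z \<bullet> b) *\<^sub>R b)" by (simp add: euclidean_representation)
    also have "\<dots> = (\<Sum>b\<in>Basis. (z \<bullet> b) * B w b)"
      by (simp add: linear_sum[OF linB(2)] linear_scale[OF linB(2)])
    also have "\<dots> = T w \<bullet> z"
      by (simp add: T_def inner_sum_left inner_commute[of z] mult.commute)
    finally show ?thesis by simp
  qed
  have linT: "linear T"
    unfolding T_def
    by (rule linearI) (simp_all add: linear_add[OF linB(1)] linear_scale[OF linB(1)]
        scaleR_add_left sum.distrib scaleR_sum_right)
  have "inj T"
  proof (subst linear_injective_0[OF linT], intro allI impI)
    fix w assume "T w = 0"
    then have "B w w = 0" using TB[of w w] by simp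
    then show "w = 0" using pos[of w] by force
  qed
  then have "surj T" using linear_injective_imp_surjective[OF linT] by blast
  then obtain w where w': "(\<Sum>b\<in>Basis. L b *\<^sub>R b) = T w" by (rule surjE)
  note w = w'[symmetric]
  have "B w z = L z" for z
  proof -
    have "L z = L (\<Sum>b\<in>Basis. (z \<bullet> b) *\<^sub>R b)" by (simp add: euclidean_representation)
    also have "\<dots> = (\<Sum>b\<in>Basis. (z \<bullet> b) * L b)"
      by (simp add: linear_sum[OF L] linear_scale[OF L])
    also have "\<dots> = T w \<bullet> z"
      by (simp add: w inner_sum_left inner_commute[of z] mult.commute)
    finally show ?thesis using TB by simp
  qed
  moreover have "w' = w''" if "\<forall>z. B w' z = L z" "\<forall>z. B w'' z = L z" for w' w''
  proof -
    have "T w' = T w''"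
      using that TB by (simp add: euclidean_eq_iff[of "T w'"])
    with \<open>inj T\<close> show ?thesis by (simp add: inj_eq)
  qed
  ultimately show ?thesis by blast
qed

lemma open_F4: "open F4"
  unfolding F4_def by (intro open_Collect_less continuous_intros)

definition F4_metric_explicit :: "(real^4) metric_field" where
  "F4_metric_explicit p u w =
     (u $ 1 - p $ 3 * u $ 2) * (w $ 1 - p $ 3 * w $ 2) / p $ 4 + p $ 4 * u $ 2 * w $ 2
     + (u $ 3 * w $ 3 + u $ 4 * w $ 4) / (4 * (p $ 4)\<^sup>2)"

lemma bilinear_F4_metric_explicit: "bilinear (F4_metric_explicit p)"
  unfolding bilinear_def F4_metric_explicit_def
  by (auto intro!: linearI simp: algebra_simps add_divide_distrib diff_divide_distrib)

lemma F4_metric_explicit_frame: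
  assumes "p \<in> F4"
  shows "F4_metric_explicit p (F4_frame i p) (F4_frame j p) = (if i = j then 1 else 0)"
proof -
  have t: "p $ 4 > 0" using assms by (simp add: F4_def)
  have sq: "sqrt (p $ 4) * sqrt (p $ 4) = p $ 4" using t by simp
  show ?thesis
    using exhaust_4[of i] exhaust_4[of j] t sq
    by (auto simp: F4_metric_explicit_def F4_frame_def Let_def axis_def power2_eq_square
        field_simps)
qed

lemma F4_frame_expansion:
  assumes "p \<in> F4"
  shows "u = ((u $ 1 - p $ 3 * u $ 2) / sqrt (p $ 4)) *\<^sub>R F4_frame 1 p
           + (sqrt (p $ 4) * u $ 2) *\<^sub>R F4_frame 2 p
           + (u $ 3 / (2 * p $ 4)) *\<^sub>R F4_frame 3 p + (u $ 4 / (2 * p $ 4)) *\<^sub>R F4_frame 4 p"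
  using assms
  by (simp add: vec_eq_iff forall_4 F4_def F4_frame_def Let_def axis_def field_simps)

lemma F4_metric_eq:
  assumes p: "p \<in> F4"
  shows "F4_metric p = F4_metric_explicit p"
  unfolding F4_metric_def
proof (rule the_equality)
  show "bilinear (F4_metric_explicit p) \<and> (\<forall>i j. F4_metric_explicit p (F4_frame i p) (F4_frame j p)
      = (if i = j then 1 else 0))"
    using bilinear_F4_metric_explicit F4_metric_explicit_frame[OF p] by blast
next
  fix B :: "real^4 \<Rightarrow> real^4 \<Rightarrow> real"
  assume B: "bilinear B \<and> (\<forall>i j. B (F4_frame i p) (F4_frame j p) = (if i = j then 1 else 0))"
  show "B = F4_metric_explicit p"
  proof (intro ext)
    fix u w
    have expand: "\<exists>a b c d. u = a *\<^sub>R F4_frame 1 p + b *\<^sub>R F4_frame 2 p + c *\<^sub>R F4_frame 3 p + d *\<^sub>R F4_frame 4 p"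
      for u
      using F4_frame_expansion[OF p, of u] by blast
    obtain a b c d where u: "u = a *\<^sub>R F4_frame 1 p + b *\<^sub>R F4_frame 2 p + c *\<^sub>R F4_frame 3 p + d *\<^sub>R F4_frame 4 p"
      using expand by blast
    obtain a' b' c' d' where w: "w = a' *\<^sub>R F4_frame 1 p + b' *\<^sub>R F4_frame 2 p + c' *\<^sub>R F4_frame 3 p + d' *\<^sub>R F4_frame 4 p"
      using expand by blast
    have val: "C u w = a * a' + b * b' + c * c' + d * d'"
      if C: "bilinear C" and on: "\<forall>i j. C (F4_frame i p) (F4_frame j p) = (if i = j then 1 else 0)"
      for C :: "real^4 \<Rightarrow> real^4 \<Rightarrow> real"
      unfolding u w
      by (simp add: bilinear_ladd[OF C] bilinear_radd[OF C] bilinear_lmul[OF C] bilinear_rmul[OF C] on)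
    show "B u w = F4_metric_explicit p u w"
      using val[of B] val[of "F4_metric_explicit p"] B bilinear_F4_metric_explicit[of p]
        F4_metric_explicit_frame[OF p] by simp
  qed
qed

lemma F4_metric_bilinear: "p \<in> F4 \<Longrightarrow> bilinear (F4_metric p)"
  by (simp add: F4_metric_eq bilinear_F4_metric_explicit)

lemma F4_metric_sym: "p \<in> F4 \<Longrightarrow> F4_metric p u w = F4_metric p w u"
  by (simp add: F4_metric_eq F4_metric_explicit_def algebra_simps)

lemma F4_metric_pos:
  assumes "p \<in> F4" "u \<noteq> 0"
  shows "F4_metric p u u > 0"
proof -
  have t: "p $ 4 > 0" using assms by (simp add: F4_def)
  define A where "A = (u $ 1 - p $ 3 * u $ 2)\<^sup>2 / p $ 4"
  define B where "B = p $ 4 * (u $ 2)\<^sup>2"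
  define C where "C = (u $ 3)\<^sup>2 / (4 * (p $ 4)\<^sup>2)"
  define D where "D = (u $ 4)\<^sup>2 / (4 * (p $ 4)\<^sup>2)"
  have eq: "F4_metric p u u = A + B + C + D"
    using assms(1)
    by (simp add: F4_metric_eq F4_metric_explicit_def A_def B_def C_def D_def power2_eq_square
        add_divide_distrib)
  have nn: "A \<ge> 0" "B \<ge> 0" "C \<ge> 0" "D \<ge> 0" using t by (simp_all add: A_def B_def C_def D_def)
  have "\<not> (A = 0 \<and> B = 0 \<and> C = 0 \<and> D = 0)"
    using assms(2) t by (auto simp: A_def B_def C_def D_def vec_eq_iff forall_4)
  with nn show ?thesis unfolding eq by linarith
qed

lemma F4_metric_differentiable:
  assumes p: "p \<in> F4"
  shows "(\<lambda>q. F4_metric q u w) differentiable (at p)"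
proof -
  have t: "p $ 4 \<noteq> 0" using p by (simp add: F4_def)
  have coord: "(\<lambda>q::real^4. q $ i) differentiable (at p)" for i
    by (rule bounded_linear_imp_differentiable[OF bounded_linear_vec_nth])
  have "(\<lambda>q. F4_metric_explicit q u w) differentiable (at p)"
    unfolding F4_metric_explicit_def
    by (intro differentiable_add differentiable_divide differentiable_mult differentiable_diff
        differentiable_const differentiable_power coord) (use t in simp_all)
  then obtain D where "((\<lambda>q. F4_metric_explicit q u w) has_derivative D) (at p)"
    by (auto simp: differentiable_def)
  then have "((\<lambda>q. F4_metric q u w) has_derivative D) (at p)"
    by (rule has_derivative_transform_within_open[OF _ open_F4 p]) (simp add: F4_metric_eq)
  then show ?thesis by (auto simp: differentiable_def)
qed

lemma frechet_cong_open:
  assumes "open S" "p \<in> S" "\<And>q. q \<in> S \<Longrightarrow> f q = h q"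
  shows "frechet_derivative f (at p) = frechet_derivative h (at p)"
proof -
  have "(f has_derivative D) (at p) \<longleftrightarrow> (h has_derivative D) (at p)" for D
    using has_derivative_transform_within_open[of f D p UNIV S h]
      has_derivative_transform_within_open[of h D p UNIV S f] assms by auto
  then show ?thesis by (simp add: frechet_derivative_def)
qed

lemma frechet_derivative_F4_metric_linear:
  assumes p: "p \<in> F4"
  shows "linear (frechet_derivative (\<lambda>q. F4_metric q u w) (at p))"
    and "linear (\<lambda>u. frechet_derivative (\<lambda>q. F4_metric q u w) (at p) z)"
    and "linear (\<lambda>w. frechet_derivative (\<lambda>q. F4_metric q u w) (at p) z)"
proof -
  let ?D = "\<lambda>u w. frechet_derivative (\<lambda>q. F4_metric q u w) (at p)"
  note d = F4_metric_differentiable[OF p]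
  have hd: "((\<lambda>q. F4_metric q u w) has_derivative ?D u w) (at p)" for u w
    using d by (simp add: frechet_derivative_works)
  show "linear (?D u w)" by (rule linear_frechet_derivative[OF d])
  have add: "?D (u + u') w z = ?D u w z + ?D u' w z" for u u' w z
  proof -
    have "?D (u + u') w = frechet_derivative (\<lambda>q. F4_metric q u w + F4_metric q u' w) (at p)"
      by (rule frechet_cong_open[OF open_F4 p]) (simp add: bilinear_ladd F4_metric_bilinear)
    also have "\<dots> = (\<lambda>z. ?D u w z + ?D u' w z)"
      by (rule frechet_derivative_at[symmetric]) (intro has_derivative_add hd)
    finally show ?thesis by simp
  qed
  have scale: "?D (r *\<^sub>R u) w z = r * ?D u w z" for r u w z
  proof -
    have "?D (r *\<^sub>R u) w = frechet_derivative (\<lambda>q. r * F4_metric q u w) (at p)"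
      by (rule frechet_cong_open[OF open_F4 p]) (simp add: bilinear_lmul F4_metric_bilinear)
    also have "\<dots> = (\<lambda>z. r * ?D u w z)"
      by (rule frechet_derivative_at[symmetric]) (intro has_derivative_mult_right hd)
    finally show ?thesis by simp
  qed
  show lin: "linear (\<lambda>u. ?D u w z)" for w by (rule linearI) (simp_all add: add scale)
  have "?D u w = ?D w u" for u w
    by (rule frechet_cong_open[OF open_F4 p]) (simp add: F4_metric_sym)
  then show "linear (\<lambda>w. ?D u w z)" using lin[of u] by simp
qed

lemma F4_christoffel:
  assumes p: "p \<in> F4"
  shows "2 * F4_metric p (christoffel F4_metric p u v) z = koszul F4_metric p u v z"
proof -
  note lin = frechet_derivative_F4_metric_linear[OF p]
  have "linear (\<lambda>z. koszul F4_metric p u v z / 2)"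
    unfolding koszul_def
    by (rule linearI)
      (simp_all add: linear_add[OF lin(1)] linear_scale[OF lin(1)] linear_add[OF lin(3)]
        linear_scale[OF lin(3)] algebra_simps add_divide_distrib diff_divide_distrib)
  from riesz_bilinear[OF F4_metric_bilinear[OF p] F4_metric_pos[OF p] this]
  have "\<exists>!w. \<forall>z. 2 * F4_metric p w z = koszul F4_metric p u v z"
    by (simp add: field_simps)
  from theI'[OF this] show ?thesis unfolding christoffel_def by blast
qed

lemma F4_metric_eqI:
  assumes p: "p \<in> F4" and "\<And>z. F4_metric p w z = F4_metric p w' z"
  shows "w = w'"
proof (rule ccontr)
  assume "w \<noteq> w'"
  then have "F4_metric p (w - w') (w - w') > 0" by (intro F4_metric_pos[OF p]) simp
  then show False using assms(2)[of "w - w'"] by (simp add: bilinear_lsub[OF F4_metric_bilinear[OF p]])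
qed

lemma F4_christoffel_linear:
  assumes p: "p \<in> F4"
  shows "linear (\<lambda>u. christoffel F4_metric p u v)"
proof -
  note lin = frechet_derivative_F4_metric_linear[OF p] and ch = F4_christoffel[OF p]
    and bil = F4_metric_bilinear[OF p]
  have kadd: "koszul F4_metric p (u + u') v z = koszul F4_metric p u v z + koszul F4_metric p u' v z"
    for u u' z
    by (simp add: koszul_def linear_add[OF lin(1)] linear_add[OF lin(2)])
  have kscale: "koszul F4_metric p (r *\<^sub>R u) v z = r * koszul F4_metric p u v z" for r u z
    by (simp add: koszul_def linear_scale[OF lin(1)] linear_scale[OF lin(2)] algebra_simps)
  show ?thesis
  proof (rule linearI)
    fix u u' show "christoffel F4_metric p (u + u') v
      = christoffel F4_metric p u v + christoffel F4_metric p u' v"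
    proof (rule F4_metric_eqI[OF p])
      fix z show "F4_metric p (christoffel F4_metric p (u + u') v) z
        = F4_metric p (christoffel F4_metric p u v + christoffel F4_metric p u' v) z"
        using ch[of "u + u'" v z] ch[of u v z] ch[of u' v z] kadd[of u u' z]
        by (simp add: bilinear_ladd[OF bil])
    qed
  next
    fix r u show "christoffel F4_metric p (r *\<^sub>R u) v = r *\<^sub>R christoffel F4_metric p u v"
    proof (rule F4_metric_eqI[OF p])
      fix z show "F4_metric p (christoffel F4_metric p (r *\<^sub>R u) v) z
        = F4_metric p (r *\<^sub>R christoffel F4_metric p u v) z"
        using ch[of "r *\<^sub>R u" v z] kscale[of r u z] unfolding ch[of u v z, symmetric]
        by (simp add: bilinear_lmul[OF bil])
    qed
  qed
qed

lemma F4_sasaki_metric_eq: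
  assumes p: "p \<in> F4"
  shows "sasaki_metric F4_metric (p, v) = (\<lambda>(a, b) (c, d). F4_metric p a c
     + F4_metric p (b + christoffel F4_metric p a v) (d + christoffel F4_metric p c v))"
    (is "_ = ?S")
proof -
  note bil = F4_metric_bilinear[OF p] and cl = F4_christoffel_linear[OF p, of v]
  have bilS: "bilinear ?S"
    unfolding bilinear_def
    by (auto intro!: linearI simp: bilinear_ladd[OF bil] bilinear_radd[OF bil]
        bilinear_lmul[OF bil] bilinear_rmul[OF bil] linear_add[OF cl] linear_scale[OF cl]
        algebra_simps)
  have "is_sasaki_form F4_metric (p, v) ?S"
    unfolding is_sasaki_form_def
    using bilS F4_metric_sym[OF p]
    by (auto simp: horizontal_lift_def vertical_lift_def linear_0[OF cl] bilinear_lzero[OF bil]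
        bilinear_rzero[OF bil])
  moreover have "B = ?S" if B: "is_sasaki_form F4_metric (p, v) B" for B
  proof (intro ext)
    fix V W :: "(real^4) \<times> (real^4)"
    have dec: "U = horizontal_lift F4_metric (p, v) (fst U)
        + vertical_lift (p, v) (snd U + christoffel F4_metric p (fst U) v)" for U :: "(real^4) \<times> (real^4)"
      by (simp add: horizontal_lift_def vertical_lift_def prod_eq_iff)
    have Bb: "bilinear B" using B by (simp add: is_sasaki_form_def)
    have Bsym: "B V W = B W V" for V W
      using B unfolding is_sasaki_form_def by blast
    have Blift: "B (horizontal_lift F4_metric (p, v) u) (horizontal_lift F4_metric (p, v) w)
          = F4_metric p u w"
        "B (vertical_lift (p, v) u) (vertical_lift (p, v) w) = F4_metric p u w"
        "B (horizontal_lift F4_metric (p, v) u) (vertical_lift (p, v) w) = 0" for u w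
      using B unfolding is_sasaki_form_def by simp_all
    have Bvh: "B (vertical_lift (p, v) u) (horizontal_lift F4_metric (p, v) w) = 0" for u w
      by (subst Bsym) (rule Blift(3))
    have "B V W = B
        (horizontal_lift F4_metric (p, v) (fst V)
          + vertical_lift (p, v) (snd V + christoffel F4_metric p (fst V) v))
        (horizontal_lift F4_metric (p, v) (fst W)
          + vertical_lift (p, v) (snd W + christoffel F4_metric p (fst W) v))"
      by (rule arg_cong2[of _ _ _ _ B, OF dec dec])
    also have "\<dots> = F4_metric p (fst V) (fst W)
        + F4_metric p (snd V + christoffel F4_metric p (fst V) v)
            (snd W + christoffel F4_metric p (fst W) v)"
      by (simp only: bilinear_ladd[OF Bb] bilinear_radd[OF Bb] Bvh Blift add_0_left add_0_right)
    finally have "B V W = \<dots>" .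
    then show "B V W = ?S V W" by (simp add: case_prod_unfold)
  qed
  ultimately show ?thesis unfolding sasaki_metric_def by (rule the_equality)
qed

end

theory Submission
  imports Defs "HOL-Complex_Analysis.Cauchy_Integral_Formula"
begin

text \<open>
  Only the horizontal part of the tension field is needed. Write \<open>Z = X\<^sub>1 + i X\<^sub>2\<close>,
  \<open>W = X\<^sub>3 + i X\<^sub>4\<close> and \<open>z = s + i t\<close>. In the frame the horizontal equations become
  \<open>4 t (Z \<partial>W - W \<partial>Z) = -3 i Z W\<close> and a first-order equation for the arguments of \<open>Z\<close> and \<open>W\<close>.
  For a nonvanishing function \<open>f\<close> the quantity \<open>Q = \<partial>f / f - cnj (dbar f / f)\<close> is
  \<open>2 i \<partial>(arg f)\<close>, so \<open>dbar Q\<close> is imaginary. If one of \<open>Z\<close>, \<open>W\<close> vanishes on an open set, the second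
  equation makes \<open>Q\<close> for the other one a nonzero imaginary multiple of \<open>1 / t\<close>, for which \<open>dbar Q\<close> is
  real and nonzero. Where both are nonzero, the first equation says that
  \<open>cnj (W / Z) / t powr (3/2)\<close> is holomorphic; differentiating the second one repeatedly then gives
  polynomial relations that contradict each other.
\<close>

section \<open>Wirtinger derivatives\<close>

text \<open>The differentiation closes up because of holomorphy. Let \<open>u\<close> be
  \<open>|W|^2 / |Z|^2\<close> and \<open>P = 2 t \<partial>(log u)\<close>. The second equation
  expresses the \<open>Q\<close> of \<open>Z\<close> through \<open>u\<close> and \<open>P\<close>,
  so the vanishing real part of \<open>dbar Q\<close> becomes a relation between \<open>u\<close>
  and \<open>|P|^2\<close>. If \<open>L\<close> is the logarithmic derivative of the holomorphic
  function, then \<open>P = 2 t L - 3 \<i>\<close> and \<open>dbar P = \<i> L\<close>, which is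
  again a function of \<open>t\<close> and \<open>P\<close>. So applying \<open>\<partial>\<close>
  to the relation adds only the unknown \<open>\<sigma> = 2 t \<partial>P\<close>, and a further
  \<open>dbar\<close> adds only \<open>cnj \<sigma>\<close>: two relations that suffice to eliminate
  \<open>\<sigma>\<close>. The factor \<open>1 - 2 u\<close> may vanish, so there is never a
  division by it. On the geometric side the obstacle is that the Christoffel symbols of the Sasaki
  metric are definite descriptions in dimension eight. Their horizontal part is read off from the
  Koszul formula by pairing with horizontal lifts.\<close>

definition has_wirtinger :: "(complex \<Rightarrow> complex) \<Rightarrow> complex \<Rightarrow> complex \<Rightarrow> complex \<Rightarrow> bool" where
  "has_wirtinger f a b z \<longleftrightarrow> (f has_derivative (\<lambda>v. a * v + b * cnj v)) (at z)"

lemma has_wirtinger_const: "has_wirtinger (\<lambda>_. c) 0 0 z"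
  by (simp add: has_wirtinger_def)

lemma has_wirtinger_Im: "has_wirtinger (\<lambda>z. of_real (Im z)) (- \<i> / 2) (\<i> / 2) z"
proof -
  have "((\<lambda>z. of_real (Im z) :: complex) has_derivative (\<lambda>v. of_real (Im v))) (at z)"
    by (intro derivative_eq_intros) auto
  moreover have "(\<lambda>v. of_real (Im v)) = (\<lambda>v. - \<i> / 2 * v + \<i> / 2 * cnj v)"
    by (auto simp: complex_eq_iff)
  ultimately show ?thesis by (simp add: has_wirtinger_def)
qed

lemma has_wirtinger_add:
  "has_wirtinger f a b z \<Longrightarrow> has_wirtinger g c d z \<Longrightarrow> has_wirtinger (\<lambda>z. f z + g z) (a + c) (b + d) z"
  unfolding has_wirtinger_def by (auto intro!: derivative_eq_intros simp: algebra_simps)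

lemma has_wirtinger_diff:
  "has_wirtinger f a b z \<Longrightarrow> has_wirtinger g c d z \<Longrightarrow> has_wirtinger (\<lambda>z. f z - g z) (a - c) (b - d) z"
  unfolding has_wirtinger_def by (auto intro!: derivative_eq_intros simp: algebra_simps)

lemma has_wirtinger_mult:
  "has_wirtinger f a b z \<Longrightarrow> has_wirtinger g c d z \<Longrightarrow>
   has_wirtinger (\<lambda>z. f z * g z) (a * g z + f z * c) (b * g z + f z * d) z"
  unfolding has_wirtinger_def by (auto intro!: derivative_eq_intros simp: algebra_simps)

lemma has_wirtinger_cmult:
  "has_wirtinger f a b z \<Longrightarrow> has_wirtinger (\<lambda>z. c * f z) (c * a) (c * b) z"
  using has_wirtinger_mult[OF has_wirtinger_const[of c]] by simp

lemma has_wirtinger_cnj: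
  assumes "has_wirtinger f a b z"
  shows "has_wirtinger (\<lambda>z. cnj (f z)) (cnj b) (cnj a) z"
  using bounded_linear.has_derivative[OF bounded_linear_cnj assms[unfolded has_wirtinger_def]]
  by (simp add: has_wirtinger_def algebra_simps)

lemma has_wirtinger_divide:
  assumes "has_wirtinger f a b z" "has_wirtinger g c d z" "g z \<noteq> 0"
  shows "has_wirtinger (\<lambda>z. f z / g z) (a / g z - f z * c / (g z)\<^sup>2) (b / g z
      - f z * d / (g z)\<^sup>2) z"
  using has_derivative_divide[OF assms(1,2)[unfolded has_wirtinger_def] assms(3)] assms(3)
  unfolding has_wirtinger_def
  by (elim has_derivative_eq_rhs) (auto simp: field_simps power2_eq_square)

text \<open>This is how an equation between functions on an open set gets differentiated: both sides
  receive Wirtinger derivatives by the calculus rules, and these must agree.\<close>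

lemma has_wirtinger_unique:
  assumes "has_wirtinger f a b z" "has_wirtinger g c d z"
    and "open S" "z \<in> S" "\<And>w. w \<in> S \<Longrightarrow> f w = g w"
  shows "a = c" "b = d"
proof -
  have "(g has_derivative (\<lambda>v. a * v + b * cnj v)) (at z)"
    by (rule has_derivative_transform_within_open[OF _ assms(3,4,5)])
      (use assms(1) in \<open>auto simp: has_wirtinger_def\<close>)
  then have eq: "a * v + b * cnj v = c * v + d * cnj v" for v
    using has_derivative_unique[OF _ assms(2)[unfolded has_wirtinger_def]] by meson
  have "a + b = c + d" using eq[of 1] by simp
  moreover have "\<i> * (a - b) = \<i> * (c - d)" using eq[of \<i>] by (simp add: algebra_simps)
  then have "a - b = c - d" by simp
  ultimately show "a = c" "b = d"
    by (metis add_diff_cancel_left' diff_add_cancel add_diff_eq mult_2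
        mult_left_cancel[of "2::complex"] zero_neq_numeral)+
qed

lemma has_wirtinger_holomorphic:
  assumes "f holomorphic_on S" "open S" "z \<in> S"
  shows "has_wirtinger f (deriv f z) 0 z"
  using holomorphic_derivI[OF assms] by (simp add: has_field_derivative_def has_wirtinger_def)

lemma holomorphic_on_wirtinger:
  assumes "open S" "\<And>z. z \<in> S \<Longrightarrow> has_wirtinger f (a z) 0 z"
  shows "f holomorphic_on S"
  using assms
  by (auto simp: holomorphic_on_open has_wirtinger_def has_field_derivative_def)

text \<open>
  The mixed derivatives \<open>dbar A\<close> and \<open>\<partial>B\<close> share the witness \<open>A2\<close>, so their equality is part of the
  notion.
\<close>

definition C2_wirtinger ::
    "complex set \<Rightarrow> (complex \<Rightarrow> complex) \<Rightarrow> (complex \<Rightarrow> complex) \<Rightarrow> (complex \<Rightarrow> complex) \<Rightarrow> bool" where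
  "C2_wirtinger S f A B \<longleftrightarrow> (\<exists>A1 A2 B2. \<forall>z\<in>S. has_wirtinger f (A z) (B z) z \<and>
     has_wirtinger A (A1 z) (A2 z) z \<and> has_wirtinger B (A2 z) (B2 z) z)"

text \<open>\<open>A / f\<close> and \<open>B / f\<close> are the two derivatives of a local
  logarithm of \<open>f\<close>. The shared \<open>q\<close> is its mixed derivative: the quotient
  rule produces an expression symmetric in \<open>A\<close> and \<open>B\<close>.\<close>

lemma C2_wirtinger_log:
  assumes "C2_wirtinger S f A B" "z \<in> S" "f z \<noteq> 0"
  obtains p q r where "has_wirtinger (\<lambda>z. A z / f z) p q z" "has_wirtinger (\<lambda>z. B z / f z) q r z"
proof -
  obtain A1 A2 B2 where d: "has_wirtinger f (A z) (B z) z" "has_wirtinger A (A1 z) (A2 z) z"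
      "has_wirtinger B (A2 z) (B2 z) z"
    using assms unfolding C2_wirtinger_def by blast
  show thesis
    using that[OF has_wirtinger_divide[OF d(2,1) assms(3)]]
      has_wirtinger_divide[OF d(3,1) assms(3)] by (simp add: mult.commute)
qed

text \<open>Conjugation turns \<open>\<partial>\<close> into \<open>dbar\<close>, so the two terms
  contribute \<open>q\<close> and \<open>- cnj q\<close>.\<close>

lemma C2_wirtinger_arg:
  assumes "C2_wirtinger S f A B" "z \<in> S" "f z \<noteq> 0"
  obtains p q where "has_wirtinger (\<lambda>z. A z / f z - cnj (B z / f z)) p q z" "Re q = 0"
proof -
  obtain p q r where d: "has_wirtinger (\<lambda>z. A z / f z) p q z" "has_wirtinger (\<lambda>z. B z / f z) q r z"
    using C2_wirtinger_log[OF assms] .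
  show thesis
    by (rule that[OF has_wirtinger_diff[OF d(1) has_wirtinger_cnj[OF d(2)]]]) simp
qed

lemma has_wirtinger_inverse_Im:
  assumes "Im z \<noteq> 0"
  shows "has_wirtinger (\<lambda>z. c / of_real (Im z)) (c * \<i> / (2 * (of_real (Im z))\<^sup>2))
           (- c * \<i> / (2 * (of_real (Im z))\<^sup>2)) z"
  using has_wirtinger_divide[OF has_wirtinger_const[of c] has_wirtinger_Im] assms by simp

lemma arg_derivative_not_const_over_Im:
  assumes f: "C2_wirtinger S f A B" and "open T" "z \<in> T" "T \<subseteq> S"
    and ne: "\<And>w. w \<in> T \<Longrightarrow> f w \<noteq> 0" and Im: "Im z \<noteq> 0"
    and eq: "\<And>w. w \<in> T \<Longrightarrow> A w / f w - cnj (B w / f w) = \<i> * of_real k / of_real (Im w)"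
  shows "k = 0"
proof -
  obtain p q where q: "has_wirtinger (\<lambda>z. A z / f z - cnj (B z / f z)) p q z" "Re q = 0"
    using C2_wirtinger_arg[OF f] assms by blast
  have "q = - (\<i> * of_real k) * \<i> / (2 * (of_real (Im z))\<^sup>2)"
    by (rule has_wirtinger_unique(2)[OF q(1) has_wirtinger_inverse_Im[OF Im] \<open>open T\<close> \<open>z \<in> T\<close> eq])
  also have "\<dots> = of_real (k / (2 * (Im z)\<^sup>2))" using Im by (simp add: field_simps)
  finally show ?thesis using q(2) Im by simp
qed

section \<open>The first-order system on the half plane\<close>

text \<open>Here \<open>e\<close> is the second equation divided by \<open>|Z|^2\<close> and
  rearranged, \<open>d\<close> is \<open>t\<close> times its \<open>dbar\<close>, and
  \<open>q\<close> is \<open>dbar Q\<close>. Multiplying \<open>d\<close> by \<open>1 - 2 u\<close>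
  allows \<open>e\<close> to eliminate \<open>Q\<close>; the real part then removes
  \<open>q\<close>.\<close>

lemma modulus_identity:
  fixes u t :: real and P Q q :: complex
  assumes t: "t \<noteq> 0"
    and e: "(1 - 2 * of_real u) * (2 * of_real t * Q - \<i>) = - 2 * of_real u * P"
    and d: "- (of_real u * cnj P) * (2 * of_real t * Q - \<i>)
        + (1 - 2 * of_real u) * (\<i> * of_real t * Q + 2 * (of_real t)\<^sup>2 * q)
        = - (of_real u * cnj P) * P - of_real u * (\<i> * P - 3)"
    and q: "Re q = 0"
  shows "u * (cmod P)\<^sup>2 = u + 1 / 2 - 4 * u\<^sup>2"
proof -
  define v :: complex where "v = of_real u"
  define k where "k = 2 * of_real t * Q - \<i>"
  define m where "m = 2 * (of_real t)\<^sup>2 * q"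
  have tQ: "\<i> * of_real t * Q = (\<i> * k - 1) / 2" by (simp add: k_def algebra_simps)
  have e': "(1 - 2 * v) * k = - 2 * v * P" using e by (simp add: v_def k_def)
  have d': "- (v * cnj P) * k + (1 - 2 * v) * ((\<i> * k - 1) / 2 + m) = - (v * cnj P) * P - v * (\<i> * P
      - 3)"
    using d unfolding tQ by (simp add: v_def k_def m_def)
  have "- (v * cnj P) * ((1 - 2 * v) * k) + (1 - 2 * v) * ((\<i> * ((1 - 2 * v) * k) - (1 - 2 * v)) / 2
      + (1 - 2 * v) * m)
      = (1 - 2 * v) * (- (v * cnj P) * k + (1 - 2 * v) * ((\<i> * k - 1) / 2 + m))"
    by (simp add: field_simps)
  also have "\<dots> = (1 - 2 * v) * (- (v * cnj P) * P - v * (\<i> * P - 3))" by (simp only: d')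
  finally have "2 * v\<^sup>2 * (P * cnj P) + (1 - 2 * v)\<^sup>2 * (m - 1 / 2) = (1 - 2 * v) * (3 * v
      - v * (P * cnj P))"
    unfolding e' by (simp add: field_simps power2_eq_square)
  moreover have "P * cnj P = of_real ((cmod P)\<^sup>2)" by (simp only: complex_norm_square)
  ultimately have "Re (of_real (2 * u\<^sup>2 * (cmod P)\<^sup>2) + of_real ((1 - 2 * u)\<^sup>2) * (m - 1 / 2))
     = Re (of_real ((1 - 2 * u) * (3 * u - u * (cmod P)\<^sup>2)))"
    by (simp add: v_def)
  moreover have "Re m = 0" using q by (simp add: m_def flip: of_real_power)
  ultimately have "2 * u\<^sup>2 * (cmod P)\<^sup>2 - (1 - 2 * u)\<^sup>2 / 2 = (1 - 2 * u) * (3 * u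
      - u * (cmod P)\<^sup>2)"
    by simp
  \<comment> \<open>The terms with \<open>u\<^sup>2 * (cmod P)\<^sup>2\<close> on the two sides
    cancel, so \<open>u * (cmod P)\<^sup>2\<close> is left with coefficient one and the case
    \<open>u = 1 / 2\<close> is included.\<close>
  then show ?thesis by (simp add: field_simps power2_eq_square)
qed

text \<open>Eliminating \<open>\<sigma>\<close> between the two equations leaves \<open>(1 - 2 u)\<^sup>2 = 0\<close>.\<close>

lemma modulus_identity_derivatives:
  fixes u :: real and P \<sigma> :: complex
  assumes N: "u * (cmod P)\<^sup>2 = u + 1 / 2 - 4 * u\<^sup>2"
    and s: "\<sigma> * cnj P = P * (4 - 8 * of_real u + \<i> * cnj P - P * cnj P)"
    and d: "(2 * \<i> * \<sigma> - P - 3 * \<i>) * cnj P + \<sigma> * cnj \<sigma>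
       = (\<i> * P - 3) * (4 - 8 * of_real u + \<i> * cnj P - P * cnj P)
       + P * (- 8 * of_real u * cnj P + \<i> * cnj \<sigma> - (\<i> * P - 3) * cnj P - P * cnj \<sigma>)"
  shows "P = 0"
proof (rule ccontr)
  assume P: "P \<noteq> 0"
  define n where "n = (cmod P)\<^sup>2"
  define k where "k = 4 - 8 * u - n"
  define K where "K = of_real k + \<i> * cnj P"
  have n: "P * cnj P = of_real n" by (simp add: n_def complex_norm_square[symmetric] del:
      of_real_power)
  have K: "4 - 8 * of_real u + \<i> * cnj P - P * cnj P = K" by (simp add: K_def k_def n)
  have s': "\<sigma> * cnj P = P * K" using s K by simp
  \<comment> \<open>The relation \<open>d\<close> contains \<open>\<sigma>\<close> only through
    \<open>\<sigma> * cnj P\<close>, its conjugate and \<open>\<sigma> * cnj \<sigma>\<close>. The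
    first two are given by \<open>s\<close>, and comparing moduli in \<open>s\<close> gives the
    third.\<close>
  have s'': "cnj \<sigma> * P = cnj P * cnj K" using arg_cong[OF s', of cnj] by simp
  have "of_real n * (\<sigma> * cnj \<sigma>) = (\<sigma> * cnj P) * (cnj \<sigma> * P)" using n by (simp add: mult_ac)
  also have "\<dots> = of_real n * (K * cnj K)" unfolding s' s'' using n by (simp add: mult_ac)
  finally have ss: "\<sigma> * cnj \<sigma> = K * cnj K" using P by (simp add: n_def)
  have "2 * \<i> * (\<sigma> * cnj P) - P * cnj P - 3 * \<i> * cnj P + \<sigma> * cnj \<sigma>
     = (\<i> * P - 3) * K - 8 * of_real u * (P * cnj P) + \<i> * (cnj \<sigma> * P) - (\<i> * P - 3) * (P * cnj P)
         - P * (cnj \<sigma> * P)"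
    using d unfolding K by (simp add: algebra_simps)
  moreover have "P * (cnj P * cnj K) = of_real n * cnj K" by (simp add: n flip: mult.assoc)
  ultimately have "2 * \<i> * (P * K) - of_real n - 3 * \<i> * cnj P + K * cnj K
     = (\<i> * P - 3) * K - 8 * of_real u * of_real n + \<i> * (cnj P * cnj K) - (\<i> * P - 3) * of_real n
         - (P * cnj P) * cnj K"
    unfolding s' s'' ss n by simp
  then have eq: "2 * \<i> * P * of_real k - 2 * (P * cnj P) - of_real n - 3 * \<i> * cnj P
      + (of_real k * of_real k + \<i> * (cnj P - P) * of_real k + P * cnj P)
     = \<i> * P * of_real k - P * cnj P - 3 * of_real k - 3 * \<i> * cnj P - 8 * of_real u * of_real n
         + \<i> * cnj P * of_real k + P * cnj P
       - (\<i> * P - 3) * of_real n - of_real n * of_real k + \<i> * P * of_real n"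
    unfolding K_def by (simp add: algebra_simps n)
  have "of_real (k * k + 3 * k - 5 * n + 8 * u * n + n * k) = (0::complex)"
    using eq unfolding n by (simp add: algebra_simps)
  then have "k * k + 3 * k - 5 * n + 8 * u * n + n * k = 0" by (simp only: of_real_eq_0_iff)
  then have "(4 - 8 * u) * (7 - 8 * u) - n * (12 - 16 * u) = 0"
    by (simp add: k_def algebra_simps)
  \<comment> \<open>The factor \<open>u\<close> makes \<open>N\<close> applicable to
    \<open>u * n\<close>. The cubic terms then cancel and \<open>- 6 * (1 - 2 * u)\<^sup>2\<close>
    remains.\<close>
  then have "u * (4 - 8 * u) * (7 - 8 * u) - (u * n) * (12 - 16 * u) = 0" by algebra
  then have "(1 - 2 * u)\<^sup>2 = 0"
    unfolding N[folded n_def] by (simp add: algebra_simps power2_eq_square)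
  then have "u = 1 / 2" by simp
  \<comment> \<open>At \<open>u = 1 / 2\<close> the right-hand side of \<open>N\<close> is zero, so
    \<open>P\<close> would vanish.\<close>
  with N P show False by (simp add: power2_eq_square)
qed

lemma no_nonvanishing_solution:
  assumes S: "open S" "z \<in> S" "\<And>w. w \<in> S \<Longrightarrow> Im w > 0"
    and Z: "C2_wirtinger S Z A B" "\<And>w. w \<in> S \<Longrightarrow> Z w \<noteq> 0"
    and W: "C2_wirtinger S W C E" "\<And>w. w \<in> S \<Longrightarrow> W w \<noteq> 0"
    and eq1: "\<And>w. w \<in> S \<Longrightarrow> 4 * of_real (Im w) * (Z w * C w - W w * A w) = - 3 * \<i> * Z w * W w"
    and eq2: "\<And>w. w \<in> S \<Longrightarrow> 4 * of_real (Im w) * ((A w * cnj (Z w) - Z w * cnj (B w))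
        - 2 * (C w * cnj (W w) - W w * cnj (E w)))
        = 2 * \<i> * (Z w * cnj (Z w) + 4 * (W w * cnj (W w)))"
  shows False
proof -
  define t where "t w = complex_of_real (Im w)" for w
  have t: "t w \<noteq> 0" "cnj (t w) = t w" if "w \<in> S" for w
    using S(3)[OF that] by (simp_all add: t_def)
  have wt: "has_wirtinger t (- \<i> / 2) (\<i> / 2) w" for w
    unfolding t_def[abs_def] by (rule has_wirtinger_Im)
  have dZ: "has_wirtinger Z (A w) (B w) w" and dW: "has_wirtinger W (C w) (E w) w" if "w \<in> S" for w
    using Z(1) W(1) that unfolding C2_wirtinger_def by blast+
  \<comment> \<open>The right-hand side is \<open>\<partial>\<close> of
    \<open>log (t powr (3/2))\<close>, because \<open>\<partial>(log t) = - \<i> / (2 t)\<close>.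
    This is the origin of the exponent.\<close>
  have eq1': "C w / W w - A w / Z w = (- 3 * \<i> / 4) / t w" if "w \<in> S" for w
    using eq1[OF that] Z(2)[OF that] W(2)[OF that] t(1)[OF that]
    by (simp add: t_def field_simps)
  \<comment> \<open>\<open>L\<close> is the logarithmic derivative of the holomorphic function \<open>cnj (W / Z) / t powr (3/2)\<close>.\<close>
  define L where "L w = cnj (E w / W w - B w / Z w) + (3 * \<i> / 4) / t w" for w
  \<comment> \<open>The derivative \<open>dbar\<close> of the first summand of \<open>L\<close> is
    the conjugate of the mixed derivative \<open>q' - q\<close> of \<open>log (W / Z)\<close>.
    Applying \<open>dbar\<close> to \<open>eq1'\<close> evaluates it, and the second summand of
    \<open>L\<close> cancels it.\<close>
  have "\<exists>l. has_wirtinger L l 0 w" if w: "w \<in> S" for w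
  proof -
    obtain p q r where Zl: "has_wirtinger (\<lambda>z. A z / Z z) p q w" "has_wirtinger (\<lambda>z. B z / Z z) q r
        w"
      using C2_wirtinger_log[OF Z(1) w Z(2)[OF w]] .
    obtain p' q' r' where Wl: "has_wirtinger (\<lambda>z. C z / W z) p' q' w" "has_wirtinger (\<lambda>z. E z / W z)
        q' r' w"
      using C2_wirtinger_log[OF W(1) w W(2)[OF w]] .
    have i: "has_wirtinger (\<lambda>w. c / t w) (c * \<i> / (2 * (t w)\<^sup>2)) (- c * \<i> / (2 * (t w)\<^sup>2)) w" for c
      unfolding t_def using S(3)[OF w] by (intro has_wirtinger_inverse_Im) simp
    have "q' - q = - (- 3 * \<i> / 4) * \<i> / (2 * (t w)\<^sup>2)"
      by (rule has_wirtinger_unique(2)[OF has_wirtinger_diff[OF Wl(1) Zl(1)] i S(1) w eq1'])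
    then have "q' - q = - 3 / (8 * (t w)\<^sup>2)" using t(1)[OF w] by (simp add: field_simps)
    from arg_cong[OF this, of cnj]
    have qq: "cnj (q' - q) + - (3 * \<i> / 4) * \<i> / (2 * (t w)\<^sup>2) = 0"
      using t[OF w] by (simp add: field_simps)
    have "has_wirtinger L (cnj (r' - r) + (3 * \<i> / 4) * \<i> / (2 * (t w)\<^sup>2))
        (cnj (q' - q) + - (3 * \<i> / 4) * \<i> / (2 * (t w)\<^sup>2)) w"
      unfolding L_def[abs_def]
      by (rule has_wirtinger_add[OF has_wirtinger_cnj[OF has_wirtinger_diff[OF Wl(2) Zl(2)]] i])
    then show ?thesis unfolding qq by blast
  qed
  then obtain l where "\<And>w. w \<in> S \<Longrightarrow> has_wirtinger L (l w) 0 w" by metis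
  then have hol: "L holomorphic_on S" by (rule holomorphic_on_wirtinger[OF S(1)])
  define L1 where "L1 = deriv L"
  define L2 where "L2 = deriv L1"
  have dL: "has_wirtinger L (L1 w) 0 w" and dL1: "has_wirtinger L1 (L2 w) 0 w" if "w \<in> S" for w
    using has_wirtinger_holomorphic[OF hol S(1) that]
      has_wirtinger_holomorphic[OF holomorphic_deriv[OF hol S(1)] S(1) that]
    by (simp_all add: L1_def L2_def)
  \<comment> \<open>If \<open>h\<close> is the holomorphic function with logarithmic derivative
    \<open>L\<close>, then \<open>u = |h|^2 t^3\<close>. Applying \<open>2 t \<partial>\<close> to
    \<open>3 log t\<close> gives the shift by \<open>- 3 * \<i>\<close>; the factor
    \<open>2 t\<close> clears the denominators.\<close>
  define P where "P w = 2 * (t w * L w) - 3 * \<i>" for w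
  define \<sigma> where "\<sigma> w = 2 * (t w * (2 * (t w * L1 w) - \<i> * L w))" for w
  have tL: "2 * (t w * L w) = P w + 3 * \<i>" for w by (simp add: P_def)
  have dP: "has_wirtinger P (2 * (t w * L1 w) - \<i> * L w) (\<i> * L w) w" if "w \<in> S" for w
    using has_wirtinger_diff[OF has_wirtinger_cmult[OF has_wirtinger_mult[OF wt dL[OF that]]]
        has_wirtinger_const[of "3 * \<i>"], of 2]
    by (simp add: P_def[abs_def] algebra_simps)
  define u where "u w = (cmod (W w))\<^sup>2 / (cmod (Z w))\<^sup>2" for w
  define U where "U w = complex_of_real (u w)" for w
  have U: "U w = (W w * cnj (W w)) / (Z w * cnj (Z w))" for w
    by (simp only: U_def u_def of_real_divide complex_norm_square)
  have U0: "U w \<noteq> 0" if "w \<in> S" for w using Z(2) W(2) that by (simp add: U_def u_def)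
  have Lc: "cnj (E w / W w) - cnj (B w / Z w) = L w - (3 * \<i> / 4) / t w" if "w \<in> S" for w
    by (simp add: L_def)
  have dU: "has_wirtinger U (U w * (L w - (3 * \<i> / 2) / t w)) (U w * cnj (L w
      - (3 * \<i> / 2) / t w)) w"
    if w: "w \<in> S" for w
  proof -
    note nz = Z(2)[OF w] W(2)[OF w]
    have zz: "Z w * cnj (Z w) \<noteq> 0" using nz by simp
    note d = has_wirtinger_divide[OF has_wirtinger_mult[OF dW[OF w] has_wirtinger_cnj[OF dW[OF w]]]
         has_wirtinger_mult[OF dZ[OF w] has_wirtinger_cnj[OF dZ[OF w]]] zz]
    have e: "L w - (3 * \<i> / 2) / t w = (C w / W w - A w / Z w) + (cnj (E w / W w)
        - cnj (B w / Z w))"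
      unfolding eq1'[OF w] Lc[OF w] by (simp add: field_simps)
    have 1: "(C w * cnj (W w) + W w * cnj (E w)) / (Z w * cnj (Z w))
        - (W w * cnj (W w)) * (A w * cnj (Z w) + Z w * cnj (B w)) / (Z w * cnj (Z w))\<^sup>2
        = U w * (L w - (3 * \<i> / 2) / t w)"
      unfolding e U using nz by (simp add: field_simps power2_eq_square)
    have 2: "(E w * cnj (W w) + W w * cnj (C w)) / (Z w * cnj (Z w))
        - (W w * cnj (W w)) * (B w * cnj (Z w) + Z w * cnj (A w)) / (Z w * cnj (Z w))\<^sup>2
        = U w * cnj (L w - (3 * \<i> / 2) / t w)"
      unfolding e U using nz by (simp add: field_simps power2_eq_square)
    show ?thesis
      using d unfolding 1 2 by (simp add: U[abs_def])
  qed
  have Lt: "2 * t w * (L w - (3 * \<i> / 2) / t w) = P w" "2 * t w * cnj (L w - (3 * \<i> / 2) / t w)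
      = cnj (P w)"
     if "w \<in> S" for w
    using t[OF that] by (simp_all add: P_def algebra_simps)
  define Q where "Q w = A w / Z w - cnj (B w / Z w)" for w
  have QW: "C w / W w - cnj (E w / W w) = Q w - L w" if "w \<in> S" for w
  proof -
    have "C w / W w - A w / Z w = - ((3 * \<i> / 4) / t w)" using eq1'[OF that] by simp
    with Lc[OF that] show ?thesis unfolding Q_def by algebra
  qed
  have e23: "(1 - 2 * U w) * (2 * (t w * Q w) - \<i>) = - 2 * (U w * P w)" if w: "w \<in> S" for w
  proof -
    note nz = Z(2)[OF w] W(2)[OF w]
    define x y where "x = Z w * cnj (Z w)" and "y = W w * cnj (W w)"
    have "A w * cnj (Z w) - Z w * cnj (B w) = x * Q w"
      using nz by (simp add: Q_def x_def field_simps)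
    moreover have "C w * cnj (W w) - W w * cnj (E w) = y * (Q w - L w)"
      unfolding QW[OF w, symmetric] y_def using nz by (simp add: field_simps)
    ultimately have "4 * t w * (x * Q w - 2 * (y * (Q w - L w))) = 2 * \<i> * (x + 4 * y)"
      using eq2[OF w] by (simp add: t_def x_def y_def)
    moreover have "y = U w * x" and "x \<noteq> 0" using nz by (simp_all add: U x_def y_def)
    ultimately have "x * (4 * t w * (Q w - 2 * (U w * (Q w - L w)))) = x * (2 * \<i> * (1 + 4 * U w))"
      by (simp add: algebra_simps)
    then have "4 * t w * (Q w - 2 * (U w * (Q w - L w))) = 2 * \<i> * (1 + 4 * U w)"
      using \<open>x \<noteq> 0\<close> by (metis mult_left_cancel)
    then have "2 * (2 * (t w * Q w)) * (1 - 2 * U w) + 4 * (U w * (2 * (t w * L w))) = 2 * \<i> * (1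
        + 4 * U w)"
      by (simp add: algebra_simps)
    then have "2 * ((1 - 2 * U w) * (2 * (t w * Q w) - \<i>)) = 2 * (- 2 * (U w * P w))"
      unfolding tL by (simp add: algebra_simps)
    then show ?thesis by simp
  qed
  have N: "u w * (cmod (P w))\<^sup>2 = u w + 1 / 2 - 4 * (u w)\<^sup>2" if w: "w \<in> S" for w
  proof -
    obtain p q where dQ: "has_wirtinger Q p q w" "Re q = 0"
      using C2_wirtinger_arg[OF Z(1) w Z(2)[OF w]] unfolding Q_def[abs_def] by blast
    note d1 = has_wirtinger_mult[OF has_wirtinger_diff[OF has_wirtinger_const has_wirtinger_cmult[OF
        dU[OF w]]]
        has_wirtinger_diff[OF has_wirtinger_cmult[OF has_wirtinger_mult[OF wt dQ(1)]]
            has_wirtinger_const]]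
    note d2 = has_wirtinger_cmult[OF has_wirtinger_mult[OF dU[OF w] dP[OF w]]]
    define M where "M = cnj (L w - (3 * \<i> / 2) / t w)"
    have "(0 - 2 * (U w * M)) * (2 * (t w * Q w) - \<i>) + (1 - 2 * U w) * (2 * (\<i> / 2 * Q w + t w * q)
        - 0)
       = - 2 * (U w * M * P w + U w * (\<i> * L w))"
      unfolding M_def by (rule has_wirtinger_unique(2)[OF d1 d2 S(1) w e23])
    from arg_cong[OF this, of "\<lambda>x. t w * x"]
    have "- (U w * (2 * t w * M)) * (2 * (t w * Q w) - \<i>) + (1 - 2 * U w) * (\<i> * t w * Q w
        + 2 * (t w)\<^sup>2 * q)
       = - (U w * (2 * t w * M)) * P w - U w * (\<i> * (2 * (t w * L w)))"
      by (simp add: algebra_simps power2_eq_square)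
    then have d: "- (U w * cnj (P w)) * (2 * t w * Q w - \<i>) + (1 - 2 * U w) * (\<i> * t w * Q w
        + 2 * (t w)\<^sup>2 * q)
       = - (U w * cnj (P w)) * P w - U w * (\<i> * P w - 3)"
      unfolding M_def Lt(2)[OF w] tL by (simp add: algebra_simps)
    show ?thesis
      by (rule modulus_identity[OF _ _ d[unfolded U_def t_def] dQ(2)])
        (use e23[OF w] S(3)[OF w] in \<open>auto simp: U_def t_def mult_ac\<close>)
  qed
  have N': "U w * (P w * cnj (P w)) = U w + 1 / 2 - 4 * (U w * U w)" if "w \<in> S" for w
    using arg_cong[OF N[OF that], of complex_of_real]
    unfolding U_def complex_norm_square[symmetric] by (simp add: power2_eq_square)
  \<comment> \<open>This is \<open>2 t \<partial>\<close> of \<open>N'\<close>, divided by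
    \<open>U\<close>.\<close>
  have s: "\<sigma> w * cnj (P w) = P w * (4 - 8 * U w + \<i> * cnj (P w) - P w * cnj (P w))"
      if w: "w \<in> S" for w
  proof -
    note d1 = has_wirtinger_mult[OF dU[OF w] has_wirtinger_mult[OF dP[OF w] has_wirtinger_cnj[OF
        dP[OF w]]]]
    note d2 = has_wirtinger_diff[OF has_wirtinger_add[OF dU[OF w] has_wirtinger_const]
        has_wirtinger_cmult[OF has_wirtinger_mult[OF dU[OF w] dU[OF w]]]]
    define M where "M = L w - (3 * \<i> / 2) / t w"
    have "U w * M * (P w * cnj (P w)) + U w * ((2 * (t w * L1 w) - \<i> * L w) * cnj (P w)
        + P w * cnj (\<i> * L w))
        = U w * M + 0 - 4 * (U w * M * U w + U w * (U w * M))"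
      unfolding M_def by (rule has_wirtinger_unique(1)[OF d1 d2 S(1) w N'])
    from arg_cong[OF this, of "\<lambda>x. 2 * t w * x"]
    have "U w * ((2 * t w * M) * (P w * cnj (P w)) + \<sigma> w * cnj (P w)
        - \<i> * P w * cnj (2 * (t w * L w)))
       = U w * ((2 * t w * M) * (1 - 8 * U w))"
      using t(2)[OF w] by (simp add: \<sigma>_def algebra_simps)
    then have "P w * (P w * cnj (P w)) + \<sigma> w * cnj (P w) - \<i> * P w * cnj (P w + 3 * \<i>) = P w * (1
        - 8 * U w)"
      unfolding M_def Lt(1)[OF w] tL using U0[OF w] by (metis mult_left_cancel)
    then show ?thesis by (simp add: algebra_simps)
  qed
  have P0: "P w = 0" if w: "w \<in> S" for w
  proof -
    \<comment> \<open>\<open>L1\<close> is holomorphic too, so \<open>L2\<close> enters only the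
      \<open>\<partial>\<close> slot: \<open>dbar \<sigma>\<close> is expressible by
      \<open>L\<close> and \<open>L1\<close>.\<close>
    have ds: "has_wirtinger \<sigma> (2 * (- \<i> / 2 * (2 * (t w * L1 w) - \<i> * L w)
        + t w * (2 * (- \<i> / 2 * L1 w + t w * L2 w) - \<i> * L1 w)))
        (2 * (\<i> / 2 * (2 * (t w * L1 w) - \<i> * L w) + t w * (2 * (\<i> / 2 * L1 w + t w * 0)
            - \<i> * 0))) w"
      unfolding \<sigma>_def[abs_def]
      by (intro has_wirtinger_mult has_wirtinger_cmult has_wirtinger_diff wt dL dL1 w)
    note dPc = has_wirtinger_cnj[OF dP[OF w]]
    note d1 = has_wirtinger_mult[OF ds dPc]
    note d2 = has_wirtinger_mult[OF dP[OF w] has_wirtinger_diff[OF has_wirtinger_add[OF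
        has_wirtinger_diff[OF has_wirtinger_const has_wirtinger_cmult[OF dU[OF w]]]
            has_wirtinger_cmult[OF dPc]]
        has_wirtinger_mult[OF dP[OF w] dPc]]]
    define M where "M = cnj (L w - (3 * \<i> / 2) / t w)"
    define p where "p = 2 * (t w * L1 w) - \<i> * L w"
    have tp: "2 * (t w * p) = \<sigma> w" by (simp add: p_def \<sigma>_def)
    have tpc: "2 * (t w * cnj p) = cnj (\<sigma> w)" using arg_cong[OF tp, of cnj] t(2)[OF w] by simp
    have "2 * (\<i> / 2 * p + t w * (2 * (\<i> / 2 * L1 w + t w * 0) - \<i> * 0)) * cnj (P w) + \<sigma> w * cnj p
      = \<i> * L w * (4 - 8 * U w + \<i> * cnj (P w) - P w * cnj (P w))
      + P w * (0 - 8 * (U w * M) + \<i> * cnj p - (\<i> * L w * cnj (P w) + P w * cnj p))"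
      unfolding M_def p_def by (rule has_wirtinger_unique(2)[OF d1 d2 S(1) w s])
    moreover have "2 * (\<i> / 2 * p + t w * (2 * (\<i> / 2 * L1 w + t w * 0) - \<i> * 0)) = 2 * \<i> * p - L w"
      by (simp add: p_def algebra_simps)
    ultimately have "(2 * \<i> * p - L w) * cnj (P w) + \<sigma> w * cnj p
      = \<i> * L w * (4 - 8 * U w + \<i> * cnj (P w) - P w * cnj (P w))
      + P w * (0 - 8 * (U w * M) + \<i> * cnj p - (\<i> * L w * cnj (P w) + P w * cnj p))" by (simp only:)
    from arg_cong[OF this, of "\<lambda>x. 2 * t w * x"]
    have "(2 * \<i> * (2 * (t w * p)) - 2 * (t w * L w)) * cnj (P w) + \<sigma> w * (2 * (t w * cnj p))
      = \<i> * (2 * (t w * L w)) * (4 - 8 * U w + \<i> * cnj (P w) - P w * cnj (P w))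
      + P w * (- 8 * (U w * (2 * t w * M)) + \<i> * (2 * (t w * cnj p))
          - (\<i> * (2 * (t w * L w)) * cnj (P w) + P w * (2 * (t w * cnj p))))"
      by (simp add: algebra_simps)
    then have d: "(2 * \<i> * \<sigma> w - P w - 3 * \<i>) * cnj (P w) + \<sigma> w * cnj (\<sigma> w)
       = (\<i> * P w - 3) * (4 - 8 * U w + \<i> * cnj (P w) - P w * cnj (P w))
       + P w * (- 8 * U w * cnj (P w) + \<i> * cnj (\<sigma> w) - (\<i> * P w - 3) * cnj (P w)
           - P w * cnj (\<sigma> w))"
      unfolding M_def Lt(2)[OF w] tL tp tpc by (simp add: algebra_simps)
    show ?thesis
      by (rule modulus_identity_derivatives[OF N[OF w] s[OF w, unfolded U_def] d[unfolded U_def]])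
  qed
  \<comment> \<open>The left-hand side is \<open>dbar P\<close>. With \<open>L z = 0\<close> the
    definition of \<open>P\<close> gives \<open>- 3 * \<i>\<close> at \<open>z\<close>, against
    \<open>P0\<close>.\<close>
  have "\<i> * L z = 0"
    by (rule has_wirtinger_unique(2)[OF dP[OF S(2)] has_wirtinger_const[of 0] S(1,2) P0])
  then show False using P0[OF S(2)] by (simp add: P_def)
qed

text \<open>The sets where \<open>Z\<close> and \<open>W\<close> are nonzero are open and, by
  \<open>no_nonvanishing_solution\<close>, disjoint. On each of them the other function vanishes,
  and \<open>eq2\<close> decouples because every term of one function has that function or its
  conjugate as a factor.\<close>

lemma half_plane_pair_vanishes:
  fixes Z W A B C E :: "complex \<Rightarrow> complex"
  defines "H \<equiv> {z. Im z > 0}"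
  assumes Z: "C2_wirtinger H Z A B" and W: "C2_wirtinger H W C E"
    and eq1: "\<And>w. w \<in> H \<Longrightarrow> 4 * of_real (Im w) * (Z w * C w - W w * A w) = - 3 * \<i> * Z w * W w"
    and eq2: "\<And>w. w \<in> H \<Longrightarrow> 4 * of_real (Im w) * ((A w * cnj (Z w) - Z w * cnj (B w))
        - 2 * (C w * cnj (W w) - W w * cnj (E w)))
        = 2 * \<i> * (Z w * cnj (Z w) + 4 * (W w * cnj (W w)))"
    and z: "z \<in> H"
  shows "Z z = 0 \<and> W z = 0"
proof -
  have oH: "open H" unfolding H_def by (rule open_halfspace_Im_gt)
  have cont: "continuous_on H Z" "continuous_on H W"
    using Z W unfolding C2_wirtinger_def has_wirtinger_def
    by (meson has_derivative_continuous continuous_at_imp_continuous_on)+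
  define HZ HW where "HZ = {z \<in> H. Z z \<noteq> 0}" and "HW = {z \<in> H. W z \<noteq> 0}"
  have "open (H \<inter> Z -` (- {0}))" "open (H \<inter> W -` (- {0}))"
    by (auto intro!: continuous_open_preimage cont oH)
  then have o: "open HZ" "open HW"
    by (simp_all add: HZ_def HW_def Int_def vimage_def)
  have sub: "C2_wirtinger T Z A B" "C2_wirtinger T W C E" if "T \<subseteq> H" for T
    using Z W that unfolding C2_wirtinger_def by blast+
  have disj: "HZ \<inter> HW = {}"
  proof (rule ccontr)
    assume "HZ \<inter> HW \<noteq> {}"
    then obtain w where w: "w \<in> HZ \<inter> HW" by blast
    have T: "HZ \<inter> HW \<subseteq> H" by (auto simp: HZ_def)
    show False
      by (rule no_nonvanishing_solution[OF open_Int[OF o] w _ sub(1)[OF T] _ sub(2)[OF T] _ eq1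
          eq2])
        (auto simp: HZ_def HW_def H_def)
  qed
  have "HZ = {}"
  proof (rule ccontr)
    assume "HZ \<noteq> {}"
    then obtain w where w: "w \<in> HZ" by blast
    \<comment> \<open>With \<open>W = 0\<close>, dividing \<open>eq2\<close> by
      \<open>4 t |Z|^2\<close> leaves the right-hand side \<open>\<i> / (2 t)\<close>.\<close>
    have "(1/2::real) = 0"
    proof (rule arg_derivative_not_const_over_Im[OF Z o(1) w])
      fix v assume v: "v \<in> HZ"
      then have "v \<in> H" "Z v \<noteq> 0" "W v = 0" "Im v \<noteq> 0"
        using disj by (auto simp: HZ_def HW_def H_def)
      moreover from this have "2 * (2 * (of_real (Im v) * (A v * cnj (Z v) - Z v * cnj (B v))))
          = 2 * (\<i> * (Z v * cnj (Z v)))"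
        using eq2[of v] by simp
      then have "2 * (of_real (Im v) * (A v * cnj (Z v) - Z v * cnj (B v))) = \<i> * (Z v * cnj (Z v))"
        by (simp only: mult_left_cancel zero_neq_numeral[symmetric] not_False_eq_True)
      ultimately show "A v / Z v - cnj (B v / Z v) = \<i> * of_real (1/2) / of_real (Im v)"
        by (simp add: field_simps)
    qed (use w in \<open>auto simp: HZ_def H_def\<close>)
    then show False by simp
  qed
  moreover have "HW = {}"
  proof (rule ccontr)
    assume "HW \<noteq> {}"
    then obtain w where w: "w \<in> HW" by blast
    \<comment> \<open>With \<open>Z = 0\<close>, dividing \<open>eq2\<close> by
      \<open>- 8 t |W|^2\<close> leaves the right-hand side \<open>- \<i> / t\<close>.\<close>
    have "(-1::real) = 0"
    proof (rule arg_derivative_not_const_over_Im[OF W o(2) w])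
      fix v assume v: "v \<in> HW"
      then have *: "v \<in> H" "W v \<noteq> 0" "Z v = 0" "Im v \<noteq> 0"
        using disj by (auto simp: HZ_def HW_def H_def)
      then have "8 * (of_real (Im v) * (C v * cnj (W v) - W v * cnj (E v)) + \<i> * (W v * cnj (W v)))
          = 0"
        using eq2[of v] by (simp add: algebra_simps)
      then have "of_real (Im v) * (C v * cnj (W v) - W v * cnj (E v)) + \<i> * (W v * cnj (W v)) = 0"
        by (simp only: mult_eq_0_iff) simp
      then show "C v / W v - cnj (E v / W v) = \<i> * of_real (-1) / of_real (Im v)"
        using * by (simp add: field_simps)
    qed (use w in \<open>auto simp: HW_def H_def\<close>)
    then show False by simp
  qed
  ultimately show ?thesis using z by (auto simp: HZ_def HW_def)
qed

section \<open>The connection and the Sasaki metric\<close>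

definition vec4 :: "real \<Rightarrow> real \<Rightarrow> real \<Rightarrow> real \<Rightarrow> real^4" where
  "vec4 a b c d = (\<chi> i. if i = 1 then a else if i = 2 then b else if i = 3 then c else d)"

lemma vec4_nth [simp]: "vec4 a b c d $ 1 = a" "vec4 a b c d $ 2 = b" "vec4 a b c d $ 3 = c"
    "vec4 a b c d $ 4 = d"
  by (simp_all add: vec4_def)

lemma has_derivative_vec_nth:
  "(f has_derivative f') F \<Longrightarrow> ((\<lambda>x. f x $ i) has_derivative (\<lambda>h. f' h $ i)) F"
  by (rule bounded_linear.has_derivative[OF bounded_linear_vec_nth])

lemma has_derivative_vec4I:
  fixes f :: "'a::real_normed_vector \<Rightarrow> real^4"
  assumes "((\<lambda>x. f x $ 1) has_derivative (\<lambda>h. f' h $ 1)) (at x within S)"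
    "((\<lambda>x. f x $ 2) has_derivative (\<lambda>h. f' h $ 2)) (at x within S)"
    "((\<lambda>x. f x $ 3) has_derivative (\<lambda>h. f' h $ 3)) (at x within S)"
    "((\<lambda>x. f x $ 4) has_derivative (\<lambda>h. f' h $ 4)) (at x within S)"
  shows "(f has_derivative f') (at x within S)"
  unfolding has_derivative_componentwise_within[of f]
  using assms by (auto simp: Basis_vec_def inner_axis forall_4 image_iff)

text \<open>The one-form \<open>dx - s dy\<close>. Divided by \<open>sqrt t\<close> it is dual to
  the first frame field, as \<open>sqrt t dy\<close> is to the second.\<close>

definition F4_alpha :: "real^4 \<Rightarrow> real^4 \<Rightarrow> real" where
  "F4_alpha p u = u $ 1 - p $ 3 * u $ 2"

lemma F4_metric_explicit_alpha:
  "F4_metric_explicit p u w = F4_alpha p u * F4_alpha p w / p $ 4 + p $ 4 * u $ 2 * w $ 2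
     + (u $ 3 * w $ 3 + u $ 4 * w $ 4) / (4 * (p $ 4)\<^sup>2)"
  by (simp add: F4_metric_explicit_def F4_alpha_def)

text \<open>The vector \<open>a\<close> is the direction in which the base point moves, while
  \<open>u\<close> and \<open>w\<close> stay constant.\<close>

definition F4_dmetric :: "real^4 \<Rightarrow> real^4 \<Rightarrow> real^4 \<Rightarrow> real^4 \<Rightarrow> real" where
  "F4_dmetric p a u w = - (a $ 3 * (u $ 2 * F4_alpha p w + F4_alpha p u * w $ 2) / p $ 4)
     + a $ 4 * (u $ 2 * w $ 2 - F4_alpha p u * F4_alpha p w / (p $ 4)\<^sup>2
        - (u $ 3 * w $ 3 + u $ 4 * w $ 4) / (2 * (p $ 4) ^ 3))"

text \<open>The \<open>dy\<close> component of the connection. It recurs in the \<open>dx\<close>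
  component of \<open>F4_conn\<close> because \<open>dx = F4_alpha + s dy\<close>.\<close>

definition F4_conn2 :: "real^4 \<Rightarrow> real^4 \<Rightarrow> real^4 \<Rightarrow> real" where
  "F4_conn2 p u v = (- (u $ 3 * F4_alpha p v + v $ 3 * F4_alpha p u) / (p $ 4)\<^sup>2
     + (u $ 4 * v $ 2 + v $ 4 * u $ 2) / p $ 4) / 2"

definition F4_conn :: "real^4 \<Rightarrow> real^4 \<Rightarrow> real^4 \<Rightarrow> real^4" where
  "F4_conn p u v = vec4
     (- (u $ 3 * v $ 2 + v $ 3 * u $ 2 + (u $ 4 * F4_alpha p v + v $ 4 * F4_alpha p u) / p $ 4) / 2
        + p $ 3 * F4_conn2 p u v)
     (F4_conn2 p u v)
     (- (u $ 4 * v $ 3 + u $ 3 * v $ 4) / p $ 4 + 2 * p $ 4 * (u $ 2 * F4_alpha p v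
         + F4_alpha p u * v $ 2))
     ((u $ 3 * v $ 3 - u $ 4 * v $ 4) / p $ 4 + 2 * F4_alpha p u * F4_alpha p v
        - 2 * (p $ 4)\<^sup>2 * u $ 2 * v $ 2)"

definition F4_dconn2 :: "real^4 \<Rightarrow> real^4 \<Rightarrow> real^4 \<Rightarrow> real^4 \<Rightarrow> real" where
  "F4_dconn2 p a u v = (a $ 3 * (u $ 3 * v $ 2 + v $ 3 * u $ 2) / (p $ 4)\<^sup>2
     + 2 * a $ 4 * (u $ 3 * F4_alpha p v + v $ 3 * F4_alpha p u) / (p $ 4) ^ 3
     - a $ 4 * (u $ 4 * v $ 2 + v $ 4 * u $ 2) / (p $ 4)\<^sup>2) / 2"

definition F4_dconn :: "real^4 \<Rightarrow> real^4 \<Rightarrow> real^4 \<Rightarrow> real^4 \<Rightarrow> real^4" where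
  "F4_dconn p a u v = vec4
     ((a $ 3 * (u $ 4 * v $ 2 + v $ 4 * u $ 2) / p $ 4
        + a $ 4 * (u $ 4 * F4_alpha p v + v $ 4 * F4_alpha p u) / (p $ 4)\<^sup>2) / 2
        + a $ 3 * F4_conn2 p u v + p $ 3 * F4_dconn2 p a u v)
     (F4_dconn2 p a u v)
     (a $ 4 * (u $ 4 * v $ 3 + u $ 3 * v $ 4) / (p $ 4)\<^sup>2
        + 2 * a $ 4 * (u $ 2 * F4_alpha p v + F4_alpha p u * v $ 2)
            - 4 * p $ 4 * a $ 3 * u $ 2 * v $ 2)
     (- a $ 4 * (u $ 3 * v $ 3 - u $ 4 * v $ 4) / (p $ 4)\<^sup>2
        - 2 * a $ 3 * (u $ 2 * F4_alpha p v + F4_alpha p u * v $ 2)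
            - 4 * p $ 4 * a $ 4 * u $ 2 * v $ 2)"

lemma F4_alpha_has_derivative:
  assumes "(b has_derivative b') (at x)" "(U has_derivative U') (at x)"
  shows "((\<lambda>x. F4_alpha (b x) (U x)) has_derivative
    (\<lambda>h. F4_alpha (b x) (U' h) - b' h $ 3 * U x $ 2)) (at x)"
  unfolding F4_alpha_def
  by (rule has_derivative_eq_rhs, (rule derivative_intros has_derivative_vec_nth assms)+)
    (auto simp: algebra_simps)

lemma F4_metric_explicit_has_derivative:
  assumes "(b has_derivative b') (at x)" "(U has_derivative U') (at x)" "(V has_derivative V') (at
      x)"
    and b: "b x \<in> F4"
  shows "((\<lambda>x. F4_metric_explicit (b x) (U x) (V x)) has_derivative
    (\<lambda>h. F4_dmetric (b x) (b' h) (U x) (V x) + F4_metric_explicit (b x) (U' h) (V x)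
       + F4_metric_explicit (b x) (U x) (V' h))) (at x)"
proof -
  have t: "b x $ 4 \<noteq> 0" "4 * (b x $ 4)\<^sup>2 \<noteq> 0" using b by (auto simp: F4_def)
  show ?thesis
    unfolding F4_metric_explicit_alpha F4_dmetric_def
    by (rule has_derivative_eq_rhs,
        (rule derivative_intros has_derivative_vec_nth F4_alpha_has_derivative assms t)+)
      (use t(1) in \<open>auto simp: fun_eq_iff field_simps power2_eq_square power3_eq_cube\<close>)
qed

lemma F4_conn2_has_derivative:
  assumes "(b has_derivative b') (at x)" "(V has_derivative V') (at x)" and b: "b x \<in> F4"
  shows "((\<lambda>x. F4_conn2 (b x) u (V x)) has_derivative
    (\<lambda>h. F4_dconn2 (b x) (b' h) u (V x) + F4_conn2 (b x) u (V' h))) (at x)"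
proof -
  have t: "b x $ 4 \<noteq> 0" "(b x $ 4)\<^sup>2 \<noteq> 0" using b by (auto simp: F4_def)
  show ?thesis
    unfolding F4_conn2_def F4_dconn2_def
    by (rule has_derivative_eq_rhs,
        (rule derivative_intros has_derivative_vec_nth F4_alpha_has_derivative assms t | simp)+)
      (use t(1) in \<open>auto simp: fun_eq_iff F4_alpha_def field_simps power2_eq_square power3_eq_cube\<close>)
qed

lemma F4_conn_has_derivative:
  assumes "(b has_derivative b') (at x)" "(V has_derivative V') (at x)" and b: "b x \<in> F4"
  shows "((\<lambda>x. F4_conn (b x) u (V x)) has_derivative
    (\<lambda>h. F4_dconn (b x) (b' h) u (V x) + F4_conn (b x) u (V' h))) (at x)"
proof -
  have t: "b x $ 4 \<noteq> 0" "(b x $ 4)\<^sup>2 \<noteq> 0" using b by (auto simp: F4_def)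
  show ?thesis
    by (rule has_derivative_vec4I; simp add: F4_conn_def F4_dconn_def;
        rule has_derivative_eq_rhs,
        (rule derivative_intros has_derivative_vec_nth F4_alpha_has_derivative
            F4_conn2_has_derivative assms t | simp)+)
      (use t(1) in \<open>auto simp: fun_eq_iff F4_alpha_def field_simps power2_eq_square power3_eq_cube\<close>)
qed

lemma bilinear_F4_dmetric: "bilinear (F4_dmetric p a)"
  unfolding bilinear_def
  by (auto intro!: linearI simp: F4_dmetric_def F4_alpha_def algebra_simps add_divide_distrib
      diff_divide_distrib)

lemma linear_F4_dmetric: "linear (\<lambda>a. F4_dmetric p a u w)"
  by (rule linearI) (simp_all add: F4_dmetric_def F4_alpha_def algebra_simps add_divide_distrib
      diff_divide_distrib)

lemma F4_conn_commute: "F4_conn p u v = F4_conn p v u"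
  by (simp add: F4_conn_def F4_conn2_def algebra_simps)

lemma linear_F4_conn: "linear (F4_conn p u)"
  by (rule linearI)
    (simp_all add: vec_eq_iff forall_4 F4_conn_def F4_conn2_def F4_alpha_def algebra_simps
       add_divide_distrib diff_divide_distrib)

lemma bilinear_F4_conn: "bilinear (F4_conn p)"
  unfolding bilinear_def using linear_F4_conn[of p] by (simp add: F4_conn_commute[of p _ "_ ::
      real^4"])

lemma F4_dconn_commute: "F4_dconn p a u v = F4_dconn p a v u"
  by (simp add: F4_dconn_def F4_dconn2_def F4_conn2_def algebra_simps)

lemma linear_F4_dconn: "linear (F4_dconn p a u)"
  by (rule linearI)
    (simp_all add: vec_eq_iff forall_4 F4_dconn_def F4_dconn2_def F4_conn2_def F4_alpha_def
        algebra_simps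
       add_divide_distrib diff_divide_distrib)

lemma linear_F4_dconn_base: "linear (\<lambda>a. F4_dconn p a u v)"
  by (rule linearI)
    (simp_all add: vec_eq_iff forall_4 F4_dconn_def F4_dconn2_def F4_conn2_def F4_alpha_def
        algebra_simps
       add_divide_distrib diff_divide_distrib)

text \<open>Metric compatibility; together with the symmetry \<open>F4_conn_commute\<close> it
  characterises the Levi-Civita connection.\<close>

lemma F4_conn_metric:
  assumes "p \<in> F4"
  shows "F4_dmetric p a u w = F4_metric_explicit p (F4_conn p a u) w
      + F4_metric_explicit p u (F4_conn p a w)"
  using assms
  by (simp add: F4_def F4_dmetric_def F4_metric_explicit_def F4_conn_def F4_conn2_def F4_alpha_def
      field_simps power2_eq_square power3_eq_cube)

lemma F4_metric_frechet:
  assumes p: "p \<in> F4"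
  shows "frechet_derivative (\<lambda>q. F4_metric q u w) (at p) a = F4_dmetric p a u w"
proof -
  have z: "F4_metric_explicit p 0 w = 0" "F4_metric_explicit p u 0 = 0"
    by (simp_all add: F4_metric_explicit_def)
  have "((\<lambda>q. F4_metric_explicit q u w) has_derivative (\<lambda>a. F4_dmetric p a u w)) (at p)"
    using F4_metric_explicit_has_derivative[OF has_derivative_ident has_derivative_const
        has_derivative_const p, of u w]
    by (simp add: z)
  then have "((\<lambda>q. F4_metric q u w) has_derivative (\<lambda>a. F4_dmetric p a u w)) (at p)"
    by (rule has_derivative_transform_within_open[OF _ open_F4 p]) (simp add: F4_metric_eq)
  from fun_cong[OF frechet_derivative_at[OF this], of a] show ?thesis by simp
qed

text \<open>Metric compatibility turns the three derivatives in the Koszul formula into six terms;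
  by symmetry of the connection four of them cancel and the other two coincide.\<close>

lemma F4_christoffel_eq:
  assumes p: "p \<in> F4"
  shows "christoffel F4_metric p u v = F4_conn p u v"
proof (rule F4_metric_eqI[OF p])
  fix z
  have sym: "F4_metric_explicit p u w = F4_metric_explicit p w u" for u w
    by (simp add: F4_metric_explicit_def algebra_simps)
  have "2 * F4_metric p (christoffel F4_metric p u v) z
      = F4_dmetric p u v z + F4_dmetric p v u z - F4_dmetric p z u v"
    unfolding F4_christoffel[OF p] by (simp add: koszul_def F4_metric_frechet[OF p])
  also have "\<dots> = 2 * F4_metric p (F4_conn p u v) z"
    unfolding F4_conn_metric[OF p] F4_metric_eq[OF p]
    by (simp add: F4_conn_commute[of p v u] F4_conn_commute[of p z]
        sym[of "F4_conn p u z"] sym[of u "F4_conn p v z"])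
  finally show "F4_metric p (christoffel F4_metric p u v) z = F4_metric p (F4_conn p u v) z" by simp
qed

text \<open>The connection map: the vertical part of a tangent vector \<open>V\<close> of the tangent bundle.\<close>

definition F4_K :: "(real^4) \<times> (real^4) \<Rightarrow> (real^4) \<times> (real^4) \<Rightarrow> real^4" where
  "F4_K P V = snd V + F4_conn (fst P) (fst V) (snd P)"

definition F4_sasaki :: "((real^4) \<times> (real^4)) metric_field" where
  "F4_sasaki P V W = F4_metric_explicit (fst P) (fst V) (fst W)
     + F4_metric_explicit (fst P) (F4_K P V) (F4_K P W)"

definition F4_dsasaki ::
    "(real^4) \<times> (real^4) \<Rightarrow> (real^4) \<times> (real^4) \<Rightarrow> (real^4) \<times> (real^4) \<Rightarrow> (real^4) \<times> (real^4) \<Rightarrow> real"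
        where
  "F4_dsasaki P H V W = F4_dmetric (fst P) (fst H) (fst V) (fst W)
     + F4_dmetric (fst P) (fst H) (F4_K P V) (F4_K P W)
     + F4_metric_explicit (fst P) (F4_dconn (fst P) (fst H) (fst V) (snd P)
         + F4_conn (fst P) (fst V) (snd H)) (F4_K P W)
     + F4_metric_explicit (fst P) (F4_K P V) (F4_dconn (fst P) (fst H) (fst W) (snd P)
         + F4_conn (fst P) (fst W) (snd H))"

lemma F4_sasaki_metric:
  assumes "fst P \<in> F4"
  shows "sasaki_metric F4_metric P = F4_sasaki P"
proof -
  have "sasaki_metric F4_metric (fst P, snd P) = F4_sasaki P"
    unfolding F4_sasaki_metric_eq[OF assms]
    using assms by (auto simp: fun_eq_iff F4_sasaki_def F4_K_def F4_christoffel_eq F4_metric_eq)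
  then show ?thesis by simp
qed

lemmas F4_metric_linear_simps =
  bilinear_ladd[OF bilinear_F4_metric_explicit] bilinear_radd[OF bilinear_F4_metric_explicit]
  bilinear_lmul[OF bilinear_F4_metric_explicit] bilinear_rmul[OF bilinear_F4_metric_explicit]
  bilinear_lneg[OF bilinear_F4_metric_explicit] bilinear_rneg[OF bilinear_F4_metric_explicit]
  bilinear_lsub[OF bilinear_F4_metric_explicit] bilinear_rsub[OF bilinear_F4_metric_explicit]
  bilinear_lzero[OF bilinear_F4_metric_explicit] bilinear_rzero[OF bilinear_F4_metric_explicit]

lemmas F4_conn_linear_simps =
  bilinear_ladd[OF bilinear_F4_conn] bilinear_radd[OF bilinear_F4_conn]
  bilinear_lmul[OF bilinear_F4_conn] bilinear_rmul[OF bilinear_F4_conn]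
  bilinear_lneg[OF bilinear_F4_conn] bilinear_rneg[OF bilinear_F4_conn]
  bilinear_lsub[OF bilinear_F4_conn] bilinear_rsub[OF bilinear_F4_conn]
  bilinear_lzero[OF bilinear_F4_conn] bilinear_rzero[OF bilinear_F4_conn]

lemma linear_F4_K: "linear (F4_K P)"
  by (rule linearI) (simp_all add: F4_K_def F4_conn_linear_simps scaleR_add_right)

lemma F4_K_has_derivative:
  assumes "fst P \<in> F4"
  shows "((\<lambda>P. F4_K P V) has_derivative
    (\<lambda>H. F4_dconn (fst P) (fst H) (fst V) (snd P) + F4_conn (fst P) (fst V) (snd H))) (at P)"
  unfolding F4_K_def
  using has_derivative_add[OF has_derivative_const F4_conn_has_derivative[OF has_derivative_fst[OF
      has_derivative_ident]
     has_derivative_snd[OF has_derivative_ident] assms]]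
  by simp

lemma F4_sasaki_frechet:
  assumes P: "fst P \<in> F4"
  shows "frechet_derivative (\<lambda>Q. sasaki_metric F4_metric Q V W) (at P) H = F4_dsasaki P H V W"
proof -
  note fst' = has_derivative_fst[OF has_derivative_ident] and K = F4_K_has_derivative[OF P]
  have "((\<lambda>Q. F4_sasaki Q V W) has_derivative (\<lambda>H. F4_dsasaki P H V W)) (at P)"
    unfolding F4_sasaki_def F4_dsasaki_def
    by (rule has_derivative_eq_rhs[OF has_derivative_add[OF
        F4_metric_explicit_has_derivative[OF fst' has_derivative_const has_derivative_const P]
        F4_metric_explicit_has_derivative[OF fst' K K P]]])
      (simp add: F4_metric_linear_simps add.assoc)
  then have "((\<lambda>Q. sasaki_metric F4_metric Q V W) has_derivative (\<lambda>H. F4_dsasaki P H V W)) (at P)"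
  proof (rule has_derivative_transform_within_open)
    show "open (F4 \<times> (UNIV :: (real^4) set))" by (intro open_Times open_F4 open_UNIV)
  qed (use P in \<open>auto simp: F4_sasaki_metric mem_Times_iff\<close>)
  from fun_cong[OF frechet_derivative_at[OF this], of H] show ?thesis by simp
qed

text \<open>\<open>christoffel\<close> is a definite description, so its Koszul equation becomes
  available only once positive definiteness of the Sasaki metric yields a unique solution.\<close>

lemma F4_sasaki_christoffel:
  assumes P: "fst P \<in> F4"
  shows "2 * F4_sasaki P (christoffel (sasaki_metric F4_metric) P U V) Z
    = F4_dsasaki P U V Z + F4_dsasaki P V U Z - F4_dsasaki P Z U V"
proof -
  note K = linear_add[OF linear_F4_K] linear_scale[OF linear_F4_K]
  note simps = F4_metric_linear_simps F4_conn_linear_simps K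
    bilinear_ladd[OF bilinear_F4_dmetric] bilinear_lmul[OF bilinear_F4_dmetric]
    bilinear_radd[OF bilinear_F4_dmetric] bilinear_rmul[OF bilinear_F4_dmetric]
    linear_add[OF linear_F4_dmetric] linear_scale[OF linear_F4_dmetric]
    linear_add[OF linear_F4_dconn] linear_scale[OF linear_F4_dconn]
    linear_add[OF linear_F4_dconn_base] linear_scale[OF linear_F4_dconn_base]
  have bil: "bilinear (F4_sasaki P)"
    unfolding bilinear_def F4_sasaki_def
    by (intro conjI allI linearI; simp add: simps distrib_left)
  have nonneg: "F4_metric_explicit (fst P) u u \<ge> 0" for u
    using F4_metric_pos[OF P, of u] by (cases "u = 0") (auto simp: F4_metric_eq[OF P]
        F4_metric_linear_simps)
  have pos: "F4_sasaki P V V > 0" if "V \<noteq> 0" for V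
  proof (cases "fst V = 0")
    case True
    then have "F4_K P V \<noteq> 0" using that by (auto simp: F4_K_def F4_conn_linear_simps prod_eq_iff)
    then show ?thesis using F4_metric_pos[OF P, of "F4_K P V"] nonneg[of "fst V"]
      by (simp add: F4_sasaki_def F4_metric_eq[OF P])
  next
    case False
    then show ?thesis using F4_metric_pos[OF P, of "fst V"] nonneg[of "F4_K P V"]
      by (simp add: F4_sasaki_def F4_metric_eq[OF P])
  qed
  have c: "F4_dconn (fst P) a (u + u') v = F4_dconn (fst P) a u v + F4_dconn (fst P) a u' v"
     "F4_dconn (fst P) a (r *\<^sub>R u) v = r *\<^sub>R F4_dconn (fst P) a u v" for a u u' v r
    using linear_add[OF linear_F4_dconn, of "fst P" a v u u'] linear_scale[OF linear_F4_dconn, of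
        "fst P" a v r u]
    by (simp_all add: F4_dconn_commute[of _ _ v])
  define k where "k Z = (F4_dsasaki P U V Z + F4_dsasaki P V U Z - F4_dsasaki P Z U V) / 2" for Z
  have "linear k"
    unfolding k_def F4_dsasaki_def
    by (rule linearI) (simp_all add: simps c algebra_simps add_divide_distrib diff_divide_distrib)
  from riesz_bilinear[OF bil pos this]
  have ex: "\<exists>!w. \<forall>z. 2 * sasaki_metric F4_metric P w z = koszul (sasaki_metric F4_metric) P U V z"
    unfolding koszul_def F4_sasaki_frechet[OF P] F4_sasaki_metric[OF P]
    by (simp add: k_def field_simps)
  from theI'[OF ex] have "\<forall>z. 2 * sasaki_metric F4_metric P (christoffel (sasaki_metric F4_metric) P
      U V) z
      = koszul (sasaki_metric F4_metric) P U V z"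
    unfolding christoffel_def .
  then show ?thesis unfolding koszul_def F4_sasaki_frechet[OF P] F4_sasaki_metric[OF P] by blast
qed

section \<open>Curvature and the horizontal part of the Sasaki connection\<close>

definition F4_curv :: "real^4 \<Rightarrow> real^4 \<Rightarrow> real^4 \<Rightarrow> real^4 \<Rightarrow> real^4" where
  "F4_curv p a b v = F4_dconn p a b v - F4_dconn p b a v + F4_conn p a (F4_conn p b v)
     - F4_conn p b (F4_conn p a v)"

text \<open>Differentiating \<open>F4_K\<close> along \<open>U\<close> and applying it to the test
  vector, minus the same with the roles exchanged, gives the curvature plus
  \<open>F4_conn p z (F4_K (p, v) U)\<close>. That extra term and its counterpart for
  \<open>V\<close> cancel against the derivative of the metric along \<open>z\<close>, by metric
  compatibility.\<close>

lemma F4_sasaki_christoffel_horizontal: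
  assumes p: "p \<in> F4"
  shows "2 * F4_metric_explicit p (fst (christoffel (sasaki_metric F4_metric) (p, v) U V)) z
    = 2 * F4_metric_explicit p (F4_conn p (fst U) (fst V)) z
      + F4_metric_explicit p (F4_K (p, v) V) (F4_curv p (fst U) z v)
      + F4_metric_explicit p (F4_K (p, v) U) (F4_curv p (fst V) z v)"
proof -
  \<comment> \<open>Testing with the horizontal lift of \<open>z\<close> isolates the horizontal component.\<close>
  define Z where "Z = (z, - F4_conn p z v)"
  have sym: "F4_metric_explicit p u w = F4_metric_explicit p w u" for u w
    by (simp add: F4_metric_explicit_def algebra_simps)
  have KZ: "F4_K (p, v) Z = 0" "fst Z = z" "snd Z = - F4_conn p z v"
      by (simp_all add: F4_K_def Z_def)
  define A where "A = F4_K (p, v) U"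
  define B where "B = F4_K (p, v) V"
  have UV: "snd U = A - F4_conn p (fst U) v" "snd V = B - F4_conn p (fst V) v"
    by (simp_all add: A_def B_def F4_K_def)
  have "2 * F4_metric_explicit p (fst (christoffel (sasaki_metric F4_metric) (p, v) U V)) z
     = 2 * F4_sasaki (p, v) (christoffel (sasaki_metric F4_metric) (p, v) U V) Z"
    by (simp add: F4_sasaki_def KZ F4_metric_linear_simps)
  also have "\<dots> = F4_dsasaki (p, v) U V Z + F4_dsasaki (p, v) V U Z - F4_dsasaki (p, v) Z U V"
    using p by (intro F4_sasaki_christoffel) simp
  also have "\<dots> = F4_dmetric p (fst U) (fst V) z + F4_dmetric p (fst V) (fst U) z
      - F4_dmetric p z (fst U) (fst V)
      + F4_metric_explicit p B (F4_curv p (fst U) z v) + F4_metric_explicit p A (F4_curv p (fst V) z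
          v)"
    unfolding F4_dsasaki_def KZ UV fst_conv snd_conv F4_conn_metric[OF p] F4_curv_def
        A_def[symmetric] B_def[symmetric]
    by (simp add: F4_metric_linear_simps F4_conn_linear_simps sym[of _ A] sym[of _ B] sym[of B A])
  also have "F4_dmetric p (fst U) (fst V) z + F4_dmetric p (fst V) (fst U) z
      - F4_dmetric p z (fst U) (fst V)
      = 2 * F4_metric_explicit p (F4_conn p (fst U) (fst V)) z"
    unfolding F4_conn_metric[OF p]
    by (simp add: F4_conn_commute[of p "fst V" "fst U"] F4_conn_commute[of p z]
        sym[of "F4_conn p (fst U) z"] sym[of "fst U" "F4_conn p (fst V) z"])
  finally show ?thesis by (simp add: A_def B_def)
qed

section \<open>Twice differentiable functions of a complex variable\<close>

text \<open>The mean value theorem is used twice: along \<open>u\<close> for the increment of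
  \<open>f\<close> in direction \<open>v\<close>, and then along \<open>v\<close> for the derivative
  in direction \<open>u\<close>.\<close>

lemma mixed_difference_mean_value:
  fixes f :: "'a::real_normed_vector \<Rightarrow> real"
  assumes h: "h > 0" and sub: "\<And>a b. 0 \<le> a \<Longrightarrow> a \<le> h \<Longrightarrow> 0 \<le> b \<Longrightarrow> b \<le> h \<Longrightarrow> p + a *\<^sub>R u + b *\<^sub>R v \<in> S"
    and D: "\<And>q. q \<in> S \<Longrightarrow> (f has_derivative D q) (at q)"
    and Du: "\<And>q. q \<in> S \<Longrightarrow> ((\<lambda>q. D q u) has_derivative Du q) (at q)"
  obtains a b where "0 < a" "a < h" "0 < b" "b < h"
    "f (p + h *\<^sub>R u + h *\<^sub>R v) - f (p + h *\<^sub>R u) - f (p + h *\<^sub>R v) + f p = h * h * Du (p + a *\<^sub>R u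
        + b *\<^sub>R v) v"
proof -
  have d1: "((\<lambda>a. f (p + a *\<^sub>R u + b *\<^sub>R v)) has_real_derivative D (p + a *\<^sub>R u
      + b *\<^sub>R v) u) (at a)"
    if "0 \<le> a" "a \<le> h" "0 \<le> b" "b \<le> h" for a b
  proof -
    have "((\<lambda>a. p + a *\<^sub>R u + b *\<^sub>R v) has_derivative (\<lambda>c. c *\<^sub>R u)) (at a)"
      by (auto intro!: derivative_eq_intros)
    from has_derivative_compose[OF this D[OF sub[OF that]]]
    show ?thesis
      using linear_scale[OF has_derivative_linear[OF D[OF sub[OF that]]]]
      by (simp add: has_field_derivative_def mult_commute_abs)
  qed
  have d2: "((\<lambda>b. D (p + a *\<^sub>R u + b *\<^sub>R v) u) has_real_derivative Du (p + a *\<^sub>R u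
      + b *\<^sub>R v) v) (at b)"
    if "0 \<le> a" "a \<le> h" "0 \<le> b" "b \<le> h" for a b
  proof -
    have "((\<lambda>b. p + a *\<^sub>R u + b *\<^sub>R v) has_derivative (\<lambda>c. c *\<^sub>R v)) (at b)"
      by (auto intro!: derivative_eq_intros)
    from has_derivative_compose[OF this Du[OF sub[OF that]]]
    show ?thesis
      using linear_scale[OF has_derivative_linear[OF Du[OF sub[OF that]]]]
      by (simp add: has_field_derivative_def mult_commute_abs)
  qed
  define g where "g a = f (p + a *\<^sub>R u + h *\<^sub>R v) - f (p + a *\<^sub>R u + 0 *\<^sub>R v)" for a
  have "\<exists>a>0. a < h \<and> g h - g 0 = (h - 0) * (D (p + a *\<^sub>R u + h *\<^sub>R v) u - D (p + a *\<^sub>R u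
      + 0 *\<^sub>R v) u)"
    unfolding g_def by (rule MVT2[OF h]) (rule DERIV_diff[OF d1 d1], use h in auto)
  then obtain a where a: "0 < a" "a < h"
      "g h - g 0 = h * (D (p + a *\<^sub>R u + h *\<^sub>R v) u - D (p + a *\<^sub>R u + 0 *\<^sub>R v) u)"
    by auto
  have "\<exists>b>0. b < h \<and> D (p + a *\<^sub>R u + h *\<^sub>R v) u - D (p + a *\<^sub>R u + 0 *\<^sub>R v) u
      = (h - 0) * Du (p + a *\<^sub>R u + b *\<^sub>R v) v"
    by (rule MVT2[OF h d2]) (use a in auto)
  then obtain b where b: "0 < b" "b < h" "D (p + a *\<^sub>R u + h *\<^sub>R v) u - D (p + a *\<^sub>R u + 0 *\<^sub>R v) u
      = h * Du (p + a *\<^sub>R u + b *\<^sub>R v) v" by auto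
  show thesis
    by (rule that[OF a(1,2) b(1,2)]) (use a(3) b(3) in \<open>simp add: g_def\<close>)
qed

text \<open>Schwarz's theorem. The second difference is symmetric in \<open>u\<close> and
  \<open>v\<close>, so both mixed derivatives take a common value at points arbitrarily near
  \<open>p\<close>. This supplies the common witness demanded by
  \<open>C2_wirtinger\<close>.\<close>

lemma mixed_derivatives_commute:
  fixes f :: "'a::real_normed_vector \<Rightarrow> real"
  assumes S: "open S" "p \<in> S"
    and D: "\<And>q. q \<in> S \<Longrightarrow> (f has_derivative D q) (at q)"
    and Du: "\<And>q. q \<in> S \<Longrightarrow> ((\<lambda>q. D q u) has_derivative Du q) (at q)"
    and Dv: "\<And>q. q \<in> S \<Longrightarrow> ((\<lambda>q. D q v) has_derivative Dv q) (at q)"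
    and cont: "continuous_on S (\<lambda>q. Du q v)" "continuous_on S (\<lambda>q. Dv q u)"
  shows "Du p v = Dv p u"
proof (rule ccontr)
  assume "Du p v \<noteq> Dv p u"
  define e where "e = \<bar>Du p v - Dv p u\<bar> / 2"
  have e: "e > 0" using \<open>Du p v \<noteq> Dv p u\<close> by (simp add: e_def)
  have "isCont (\<lambda>q. Du q v) p" "isCont (\<lambda>q. Dv q u) p"
    using cont S by (simp_all add: continuous_on_eq_continuous_at)
  then have "((\<lambda>q. Du q v) \<longlongrightarrow> Du p v) (nhds p)" "((\<lambda>q. Dv q u) \<longlongrightarrow> Dv p u) (nhds p)"
    unfolding isCont_def tendsto_at_iff_tendsto_nhds[of "\<lambda>q. Du q v"]
      tendsto_at_iff_tendsto_nhds[of "\<lambda>q. Dv q u"] by simp_all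
  from this[THEN tendstoD, OF e]
  have "\<forall>\<^sub>F q in nhds p. \<bar>Du q v - Du p v\<bar> < e" "\<forall>\<^sub>F q in nhds p. \<bar>Dv q u - Dv p u\<bar> < e"
    by (simp_all add: dist_real_def)
  moreover have "\<forall>\<^sub>F q in nhds p. q \<in> S" using S by (rule eventually_nhds_in_open)
  ultimately have "\<forall>\<^sub>F q in nhds p. q \<in> S \<and> \<bar>Du q v - Du p v\<bar> < e \<and> \<bar>Dv q u - Dv p u\<bar> < e"
    by eventually_elim auto
  then obtain d where d: "d > 0" and ball: "\<And>q. dist q p < d \<Longrightarrow> q \<in> S \<and> \<bar>Du q v - Du p v\<bar> < e
      \<and> \<bar>Dv q u - Dv p u\<bar> < e"
    by (auto simp: eventually_nhds_metric)
  \<comment> \<open>Small enough for the parallelogram with sides \<open>h\<close> times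
    \<open>u\<close> and \<open>h\<close> times \<open>v\<close> to stay within distance
    \<open>d\<close> of \<open>p\<close>.\<close>
  define h where "h = d / (norm u + norm v + 1)"
  have n: "norm u + norm v + 1 > 0" by (simp add: add_nonneg_pos)
  have h: "h > 0" using d n by (simp add: h_def)
  have near: "dist (p + a *\<^sub>R u + b *\<^sub>R v) p < d" if "0 \<le> a" "a \<le> h" "0 \<le> b" "b \<le> h" for a b
  proof -
    have "dist (p + a *\<^sub>R u + b *\<^sub>R v) p \<le> a * norm u + b * norm v"
      using norm_triangle_ineq[of "a *\<^sub>R u" "b *\<^sub>R v"] that by (simp add: dist_norm algebra_simps)
    also have "\<dots> \<le> h * norm u + h * norm v"
      using that by (intro add_mono mult_right_mono) auto
    also have "\<dots> < h * (norm u + norm v + 1)" using h by (simp add: algebra_simps)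
    also have "\<dots> = d" using n by (simp add: h_def)
    finally show ?thesis .
  qed
  have sub: "p + a *\<^sub>R u + b *\<^sub>R v \<in> S" "p + a *\<^sub>R v + b *\<^sub>R u \<in> S"
    if "0 \<le> a" "a \<le> h" "0 \<le> b" "b \<le> h" for a b
    using ball near[of a b] near[of b a] that by (auto simp: algebra_simps)
  obtain a b where ab: "0 < a" "a < h" "0 < b" "b < h"
    "f (p + h *\<^sub>R u + h *\<^sub>R v) - f (p + h *\<^sub>R u) - f (p + h *\<^sub>R v) + f p = h * h * Du (p + a *\<^sub>R u
        + b *\<^sub>R v) v"
    using mixed_difference_mean_value[OF h sub(1) D Du] .
  obtain a' b' where ab': "0 < a'" "a' < h" "0 < b'" "b' < h"
    "f (p + h *\<^sub>R v + h *\<^sub>R u) - f (p + h *\<^sub>R v) - f (p + h *\<^sub>R u) + f p = h * h * Dv (p + a' *\<^sub>R v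
        + b' *\<^sub>R u) u"
    using mixed_difference_mean_value[OF h sub(2) D Dv] .
  have "h * h * Du (p + a *\<^sub>R u + b *\<^sub>R v) v = h * h * Dv (p + b' *\<^sub>R u + a' *\<^sub>R v) u"
    using ab(5) ab'(5) by (simp add: algebra_simps)
  then have "Du (p + a *\<^sub>R u + b *\<^sub>R v) v = Dv (p + b' *\<^sub>R u + a' *\<^sub>R v) u" using h by simp
  then show False
    using ball[OF near[of a b]] ball[OF near[of b' a']] ab ab' e unfolding e_def
    by (auto simp: abs_if split: if_splits)
qed

lemma has_wirtinger_eq:
  assumes "has_wirtinger f a b z" "\<And>w. g w = f w" "c = a" "d = b"
  shows "has_wirtinger g c d z"
proof -
  have "g = f" using assms(2) by blast
  with assms show ?thesis by simp
qed

lemma has_wirtinger_real: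
  assumes "(f has_derivative F) (at z)"
  shows "has_wirtinger (\<lambda>z. of_real (f z)) ((of_real (F 1) - \<i> * of_real (F \<i>)) / 2)
    ((of_real (F 1) + \<i> * of_real (F \<i>)) / 2) z"
proof -
  have lin: "linear F" using assms by (rule has_derivative_linear)
  have F: "F v = Re v * F 1 + Im v * F \<i>" for v
  proof -
    have "F v = F (Re v *\<^sub>R 1 + Im v *\<^sub>R \<i>)"
      by (rule arg_cong[of _ _ F]) (simp add: complex_eq_iff)
    then show ?thesis by (simp add: linear_add[OF lin] linear_scale[OF lin])
  qed
  have "((\<lambda>z. of_real (f z)) has_derivative (\<lambda>v. complex_of_real (F v))) (at z)"
    by (rule has_derivative_of_real[OF assms])
  moreover have "(\<lambda>v. complex_of_real (F v)) = (\<lambda>v. (of_real (F 1) - \<i> * of_real (F \<i>)) / 2 * v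
      + (of_real (F 1) + \<i> * of_real (F \<i>)) / 2 * cnj v)"
  proof
    fix v show "complex_of_real (F v) = (of_real (F 1) - \<i> * of_real (F \<i>)) / 2 * v
      + (of_real (F 1) + \<i> * of_real (F \<i>)) / 2 * cnj v"
      by (subst F) (simp add: complex_eq_iff field_simps)
  qed
  ultimately show ?thesis by (simp add: has_wirtinger_def)
qed

text \<open>Hiding the derivatives makes closure under sums and products a matter of plain rules.
  \<open>C2_wirtinger_of_C2_complex\<close> recovers prescribed derivatives by uniqueness.\<close>

definition C2_complex :: "complex set \<Rightarrow> (complex \<Rightarrow> complex) \<Rightarrow> bool" where
  "C2_complex S f \<longleftrightarrow> (\<exists>A B. C2_wirtinger S f A B)"

lemma C2_complexI:
  assumes "\<And>z. z \<in> S \<Longrightarrow> has_wirtinger f (A z) (B z) z"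
    "\<And>z. z \<in> S \<Longrightarrow> has_wirtinger A (A1 z) (A2 z) z" "\<And>z. z \<in> S \<Longrightarrow> has_wirtinger B (A2 z) (B2 z) z"
  shows "C2_complex S f"
  using assms unfolding C2_complex_def C2_wirtinger_def by blast

lemma C2_complexE:
  assumes "C2_complex S f"
  obtains A B A1 A2 B2 where "\<And>z. z \<in> S \<Longrightarrow> has_wirtinger f (A z) (B z) z"
    "\<And>z. z \<in> S \<Longrightarrow> has_wirtinger A (A1 z) (A2 z) z" "\<And>z. z \<in> S \<Longrightarrow> has_wirtinger B (A2 z) (B2 z) z"
  using assms unfolding C2_complex_def C2_wirtinger_def by blast

lemma C2_complex_const: "C2_complex S (\<lambda>_. c)"
  by (rule C2_complexI has_wirtinger_const)+

lemma C2_complex_add: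
  assumes "C2_complex S f" "C2_complex S g"
  shows "C2_complex S (\<lambda>z. f z + g z)"
proof -
  obtain A B A1 A2 B2 where f: "\<And>z. z \<in> S \<Longrightarrow> has_wirtinger f (A z) (B z) z"
    "\<And>z. z \<in> S \<Longrightarrow> has_wirtinger A (A1 z) (A2 z) z" "\<And>z. z \<in> S \<Longrightarrow> has_wirtinger B (A2 z) (B2 z) z"
    using C2_complexE[OF assms(1)] by blast
  obtain C E C1 C2 E2 where g: "\<And>z. z \<in> S \<Longrightarrow> has_wirtinger g (C z) (E z) z"
    "\<And>z. z \<in> S \<Longrightarrow> has_wirtinger C (C1 z) (C2 z) z" "\<And>z. z \<in> S \<Longrightarrow> has_wirtinger E (C2 z) (E2 z) z"
    using C2_complexE[OF assms(2)] by blast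
  show ?thesis
    by (rule C2_complexI has_wirtinger_add[OF f(1) g(1)] has_wirtinger_add[OF f(2) g(2)]
        has_wirtinger_add[OF f(3) g(3)] | assumption)+
qed

lemma C2_complex_mult:
  assumes "C2_complex S f" "C2_complex S g"
  shows "C2_complex S (\<lambda>z. f z * g z)"
proof -
  obtain A B A1 A2 B2 where f: "\<And>z. z \<in> S \<Longrightarrow> has_wirtinger f (A z) (B z) z"
    "\<And>z. z \<in> S \<Longrightarrow> has_wirtinger A (A1 z) (A2 z) z" "\<And>z. z \<in> S \<Longrightarrow> has_wirtinger B (A2 z) (B2 z) z"
    using C2_complexE[OF assms(1)] by blast
  obtain C E C1 C2 E2 where g: "\<And>z. z \<in> S \<Longrightarrow> has_wirtinger g (C z) (E z) z"
    "\<And>z. z \<in> S \<Longrightarrow> has_wirtinger C (C1 z) (C2 z) z" "\<And>z. z \<in> S \<Longrightarrow> has_wirtinger E (C2 z) (E2 z) z"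
    using C2_complexE[OF assms(2)] by blast
  show ?thesis
  proof (rule C2_complexI)
    fix z assume z: "z \<in> S"
    show "has_wirtinger (\<lambda>z. f z * g z) (A z * g z + f z * C z) (B z * g z + f z * E z) z"
      by (rule has_wirtinger_mult[OF f(1) g(1), OF z z])
    show "has_wirtinger (\<lambda>z. A z * g z + f z * C z) (A1 z * g z + A z * C z + (A z * C z
        + f z * C1 z))
        (A2 z * g z + A z * E z + (B z * C z + f z * C2 z)) z"
      by (rule has_wirtinger_add[OF has_wirtinger_mult[OF f(2) g(1)] has_wirtinger_mult[OF f(1)
          g(2)], OF z z z z])
    have "has_wirtinger (\<lambda>z. B z * g z + f z * E z) (A2 z * g z + B z * C z + (A z * E z
        + f z * C2 z))
        (B2 z * g z + B z * E z + (B z * E z + f z * E2 z)) z"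
      by (rule has_wirtinger_add[OF has_wirtinger_mult[OF f(3) g(1)] has_wirtinger_mult[OF f(1)
          g(3)], OF z z z z])
    then show "has_wirtinger (\<lambda>z. B z * g z + f z * E z) (A2 z * g z + A z * E z + (B z * C z
        + f z * C2 z))
        (B2 z * g z + B z * E z + (B z * E z + f z * E2 z)) z"
      by (simp add: add_ac)
  qed
qed

lemma C2_wirtinger_of_C2_complex:
  assumes S: "open S" and "C2_complex S f" and d: "\<And>z. z \<in> S \<Longrightarrow> has_wirtinger f (A z) (B z) z"
  shows "C2_wirtinger S f A B"
proof -
  obtain A' B' A1 A2 B2 where f: "\<And>z. z \<in> S \<Longrightarrow> has_wirtinger f (A' z) (B' z) z"
    "\<And>z. z \<in> S \<Longrightarrow> has_wirtinger A' (A1 z) (A2 z) z" "\<And>z. z \<in> S \<Longrightarrow> has_wirtinger B' (A2 z) (B2 z) z"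
    using C2_complexE[OF assms(2)] by blast
  have eq: "A' z = A z" "B' z = B z" if "z \<in> S" for z
    using has_wirtinger_unique[OF f(1)[OF that] d[OF that] S that] by simp_all
  have "has_wirtinger A (A1 z) (A2 z) z" if z: "z \<in> S" for z
    using f(2)[OF z] unfolding has_wirtinger_def
    by (rule has_derivative_transform_within_open[OF _ S z eq(1)])
  moreover have "has_wirtinger B (A2 z) (B2 z) z" if z: "z \<in> S" for z
    using f(3)[OF z] unfolding has_wirtinger_def
    by (rule has_derivative_transform_within_open[OF _ S z eq(2)])
  ultimately show ?thesis using d unfolding C2_wirtinger_def by blast
qed

text \<open>Once the mixed real derivatives agree, applying \<open>\<partial>\<close> and
  \<open>dbar\<close> in either order gives a quarter of the Laplacian.\<close>

lemma C2_complex_real: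
  assumes S: "open S"
    and f: "\<And>z. z \<in> S \<Longrightarrow> (f has_derivative D z) (at z)"
    and D1: "\<And>z. z \<in> S \<Longrightarrow> ((\<lambda>z. D z 1) has_derivative D1 z) (at z)"
    and Di: "\<And>z. z \<in> S \<Longrightarrow> ((\<lambda>z. D z \<i>) has_derivative Di z) (at z)"
    and cont: "continuous_on S (\<lambda>z. D1 z \<i>)" "continuous_on S (\<lambda>z. Di z 1)"
  shows "C2_complex S (\<lambda>z. of_real (f z))"
proof (rule C2_complexI)
  fix z assume z: "z \<in> S"
  have sym: "Di z 1 = D1 z \<i>"
    using mixed_derivatives_commute[OF S z f D1 Di cont] by simp
  show "has_wirtinger (\<lambda>z. of_real (f z)) ((of_real (D z 1) - \<i> * of_real (D z \<i>)) / 2)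
      ((of_real (D z 1) + \<i> * of_real (D z \<i>)) / 2) z"
    by (rule has_wirtinger_real[OF f[OF z]])
  note w = has_wirtinger_real[OF D1[OF z]] has_wirtinger_cmult[OF has_wirtinger_real[OF Di[OF z]],
      of \<i>]
  show "has_wirtinger (\<lambda>z. (of_real (D z 1) - \<i> * of_real (D z \<i>)) / 2)
     ((of_real (D1 z 1) - 2 * \<i> * of_real (D1 z \<i>) - of_real (Di z \<i>)) / 4)
     ((of_real (D1 z 1) + of_real (Di z \<i>)) / 4) z"
    by (rule has_wirtinger_eq[OF has_wirtinger_cmult[OF has_wirtinger_diff[OF w], of "1 / 2"]])
      (simp_all add: sym field_simps)
  show "has_wirtinger (\<lambda>z. (of_real (D z 1) + \<i> * of_real (D z \<i>)) / 2)
     ((of_real (D1 z 1) + of_real (Di z \<i>)) / 4)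
     ((of_real (D1 z 1) + 2 * \<i> * of_real (D1 z \<i>) - of_real (Di z \<i>)) / 4) z"
    by (rule has_wirtinger_eq[OF has_wirtinger_cmult[OF has_wirtinger_add[OF w], of "1 / 2"]])
      (simp_all add: sym field_simps)
qed

lemma C2_complex_Re: "C2_complex S (\<lambda>z. of_real (Re z))"
proof (rule C2_complexI)
  fix z
  show "has_wirtinger (\<lambda>z. of_real (Re z)) (1 / 2) (1 / 2) z"
    using has_wirtinger_real[OF bounded_linear_imp_has_derivative[OF bounded_linear_Re]] by simp
qed (rule has_wirtinger_const)+

text \<open>The exponents \<open>1/2\<close>, \<open>-1/2\<close> and \<open>-1\<close> are those of
  the coefficients of the coframe.\<close>

lemma C2_complex_Im_powr: "C2_complex {z. Im z > 0} (\<lambda>z. of_real (Im z powr a))"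
proof (rule C2_complexI)
  fix z assume "z \<in> {z. Im z > 0}"
  then have z: "Im z > 0" by simp
  have d: "((\<lambda>z. Im z powr b) has_derivative (\<lambda>h. b * Im z powr (b - 1) * Im h)) (at z)" for b
  proof -
    have "(Im has_derivative Im) (at z)" by (rule bounded_linear_imp_has_derivative[OF
        bounded_linear_Im])
    from has_derivative_compose[OF this has_real_derivative_powr[OF z, unfolded
        has_field_derivative_def]]
    show ?thesis .
  qed
  have w: "has_wirtinger (\<lambda>z. of_real (Im z powr b)) (- \<i> / 2 * of_real (b * Im z powr (b - 1)))
      (\<i> / 2 * of_real (b * Im z powr (b - 1))) z" for b
    using has_wirtinger_real[OF d] by simp
  show "has_wirtinger (\<lambda>z. of_real (Im z powr a)) (- \<i> / 2 * of_real (a * Im z powr (a - 1)))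
      (\<i> / 2 * of_real (a * Im z powr (a - 1))) z" by (rule w)
  note w' = has_wirtinger_cmult[OF w[of "a - 1"]]
  show "has_wirtinger (\<lambda>z. - \<i> / 2 * of_real (a * Im z powr (a - 1)))
      (- of_real (a * (a - 1) * Im z powr (a - 2)) / 4) (of_real (a * (a - 1) * Im z powr (a
          - 2)) / 4) z"
    by (rule has_wirtinger_eq[OF w'[of "- \<i> / 2 * of_real a"]]) (simp_all add: mult_ac)
  show "has_wirtinger (\<lambda>z. \<i> / 2 * of_real (a * Im z powr (a - 1)))
      (of_real (a * (a - 1) * Im z powr (a - 2)) / 4) (- of_real (a * (a - 1) * Im z powr (a
          - 2)) / 4) z"
    by (rule has_wirtinger_eq[OF w'[of "\<i> / 2 * of_real a"]]) (simp_all add: mult_ac)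
qed

section \<open>The horizontal part of the tension field\<close>

definition F4_coframe :: "4 \<Rightarrow> real^4 \<Rightarrow> real^4 \<Rightarrow> real" where
  "F4_coframe i p u = (if i = 1 then F4_alpha p u / sqrt (p $ 4)
     else if i = 2 then sqrt (p $ 4) * u $ 2
     else if i = 3 then u $ 3 / (2 * p $ 4) else u $ 4 / (2 * p $ 4))"

lemma F4_coframe_frame:
  assumes "p \<in> F4"
  shows "F4_coframe i p (F4_frame j p) = (if i = j then 1 else 0)"
  using exhaust_4[of i] exhaust_4[of j] assms
  by (auto simp: F4_def F4_coframe_def F4_alpha_def F4_frame_def Let_def axis_def)

lemma linear_F4_coframe: "linear (F4_coframe i p)"
  by (rule linearI) (auto simp: F4_coframe_def F4_alpha_def algebra_simps add_divide_distrib
      diff_divide_distrib)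

lemma F4_frame_representation:
  assumes "p \<in> F4"
  shows "u = (\<Sum>i\<in>UNIV. F4_coframe i p u *\<^sub>R F4_frame i p)"
  using F4_frame_expansion[OF assms, of u] by (simp add: sum_4 F4_coframe_def F4_alpha_def)

lemma F4_metric_coframe:
  assumes p: "p \<in> F4"
  shows "F4_metric_explicit p u w = (\<Sum>i\<in>UNIV. F4_coframe i p u * F4_coframe i p w)"
proof -
  have t: "p $ 4 > 0" "sqrt (p $ 4) * sqrt (p $ 4) = p $ 4" using p by (auto simp: F4_def)
  show ?thesis
    using t by (simp add: sum_4 F4_coframe_def F4_metric_explicit_alpha field_simps
        power2_eq_square)
qed

lemma F4_sharp:
  assumes p: "p \<in> F4"
  shows "sharp F4_metric p b = (\<Sum>j\<in>UNIV. (F4_frame j p \<bullet> b) *\<^sub>R F4_frame j p)"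
proof -
  define w where "w = (\<Sum>j\<in>UNIV. (F4_frame j p \<bullet> b) *\<^sub>R F4_frame j p)"
  have w: "F4_metric p w z = b \<bullet> z" for z
  proof -
    have "F4_metric p w z = (\<Sum>j\<in>UNIV. (F4_frame j p \<bullet> b) * F4_coframe j p z)"
      unfolding F4_metric_eq[OF p] F4_metric_coframe[OF p] w_def
      by (simp add: linear_sum[OF linear_F4_coframe] linear_scale[OF linear_F4_coframe]
          F4_coframe_frame[OF p]
          if_distrib[of "\<lambda>x. _ * x"] cong: if_cong)
    also have "\<dots> = (\<Sum>j\<in>UNIV. F4_coframe j p z *\<^sub>R F4_frame j p) \<bullet> b"
      by (simp add: inner_sum_left mult.commute)
    also have "\<dots> = b \<bullet> z"
      unfolding F4_frame_representation[OF p, symmetric] by (rule inner_commute)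
    finally show ?thesis .
  qed
  show ?thesis
    unfolding sharp_def w_def[symmetric]
  proof (rule the_equality)
    show "v = w" if "\<forall>z. F4_metric p v z = b \<bullet> z" for v
      by (rule F4_metric_eqI[OF p]) (simp add: that w)
  qed (simp add: w)
qed

text \<open>\<open>metric_trace\<close> pairs the standard basis with its gradients. Both orders of
  the arguments occur, since the horizontal part of the second fundamental form appears as
  \<open>T v u + T u v\<close>.\<close>

lemma F4_metric_trace_bilinear:
  fixes T :: "real^4 \<Rightarrow> real^4 \<Rightarrow> real"
  assumes p: "p \<in> F4" and T: "bilinear T"
  shows "(\<Sum>b\<in>Basis. T b (sharp F4_metric p b)) = (\<Sum>j\<in>UNIV. T (F4_frame j p) (F4_frame j p))"
    "(\<Sum>b\<in>Basis. T (sharp F4_metric p b) b) = (\<Sum>j\<in>UNIV. T (F4_frame j p) (F4_frame j p))"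
proof -
  have lin: "linear (\<lambda>x. T x y)" "linear (T x)" for x y using T by (auto simp: bilinear_def)
  have 1: "(\<Sum>b\<in>Basis. (x \<bullet> b) * T b y) = T x y" for x y
    using linear_sum[OF lin(1), of "\<lambda>b. (x \<bullet> b) *\<^sub>R b" Basis y]
    by (simp add: linear_scale[OF lin(1)] euclidean_representation)
  have 2: "(\<Sum>b\<in>Basis. (x \<bullet> b) * T y b) = T y x" for x y
    using linear_sum[OF lin(2), of y "\<lambda>b. (x \<bullet> b) *\<^sub>R b" Basis]
    by (simp add: linear_scale[OF lin(2)] euclidean_representation)
  have "(\<Sum>b\<in>Basis. T b (sharp F4_metric p b))
      = (\<Sum>j\<in>UNIV. \<Sum>b\<in>Basis. (F4_frame j p \<bullet> b) * T b (F4_frame j p))"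
    unfolding F4_sharp[OF p] by (subst sum.swap) (simp add: linear_sum[OF lin(2)] linear_scale[OF
        lin(2)])
  then show "(\<Sum>b\<in>Basis. T b (sharp F4_metric p b)) = (\<Sum>j\<in>UNIV. T (F4_frame j p) (F4_frame j p))"
    by (simp only: 1)
  have "(\<Sum>b\<in>Basis. T (sharp F4_metric p b) b)
      = (\<Sum>j\<in>UNIV. \<Sum>b\<in>Basis. (F4_frame j p \<bullet> b) * T (F4_frame j p) b)"
    unfolding F4_sharp[OF p] by (subst sum.swap) (simp add: linear_sum[OF lin(1)] linear_scale[OF
        lin(1)])
  then show "(\<Sum>b\<in>Basis. T (sharp F4_metric p b) b) = (\<Sum>j\<in>UNIV. T (F4_frame j p) (F4_frame j p))"
    by (simp only: 2)
qed

lemma section_frechet: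
  assumes "(X has_derivative D) (at p)"
  shows "frechet_derivative (\<lambda>p. (p, X p)) (at p) v = (v, D v)"
  using fun_cong[OF frechet_derivative_at[OF has_derivative_Pair[OF has_derivative_ident assms]], of
      v]
  by simp

text \<open>
  The sum is the horizontal part of the tension field paired with \<open>z\<close>: by the pair symmetry of the
  curvature tensor, \<open>g(\<nabla>\<^sub>j X, R(e\<^sub>j, z) X) = g(R(X, \<nabla>\<^sub>j X) e\<^sub>j, z)\<close>.
\<close>

lemma harmonic_section_F4:
  assumes p: "p \<in> F4"
    and X: "\<And>q. q \<in> F4 \<Longrightarrow> (X has_derivative D q) (at q)"
    and D: "\<And>v. (\<lambda>q. D q v) differentiable (at p)"
    and harm: "tension_field F4_metric (sasaki_metric F4_metric) (\<lambda>p. (p, X p)) p = 0"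
  shows "(\<Sum>j\<in>UNIV. F4_metric_explicit p (D p (F4_frame j p) + F4_conn p (F4_frame j p) (X p))
      (F4_curv p (F4_frame j p) z (X p))) = 0"
proof -
  let ?S = "second_fundamental_form F4_metric (sasaki_metric F4_metric) (\<lambda>p. (p, X p)) p"
  define T where "T u v = F4_metric_explicit p (D p u
      + F4_conn p u (X p)) (F4_curv p v z (X p))" for u v
  have S: "2 * F4_metric_explicit p (fst (?S u v)) z = T v u + T u v" for u v
  proof -
    obtain d where d: "((\<lambda>q. D q v) has_derivative d) (at p)"
      using D by (auto simp: differentiable_def)
    \<comment> \<open>The section covers the identity, so its second coordinate derivative is
      vertical. Horizontally only the difference of the two connections remains, in which
      \<open>F4_conn p u v\<close> cancels and the curvature terms survive.\<close>
    have "frechet_derivative (\<lambda>q. frechet_derivative (\<lambda>p. (p, X p)) (at q) v) (at p)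
        = frechet_derivative (\<lambda>q. (v, D q v)) (at p)"
      by (rule frechet_cong_open[OF open_F4 p]) (rule section_frechet[OF X])
    also have "\<dots> = (\<lambda>u. (0, d u))"
      by (rule frechet_derivative_at[OF has_derivative_Pair[OF has_derivative_const d], symmetric])
    finally have "fst (?S u v) = fst (christoffel (sasaki_metric F4_metric) (p, X p) (u, D p u) (v,
        D p v)) - F4_conn p u v"
      by (simp add: second_fundamental_form_def section_frechet[OF X[OF p]] F4_christoffel_eq[OF p])
    then show ?thesis
      using F4_sasaki_christoffel_horizontal[OF p, of "X p" "(u, D p u)" "(v, D p v)" z]
      by (simp add: T_def F4_K_def F4_metric_linear_simps)
  qed
  have linD: "linear (D p)" by (rule has_derivative_linear[OF X[OF p]])
  have "F4_dconn p z (a + b) v = F4_dconn p z a v + F4_dconn p z b v"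
       "F4_dconn p z (r *\<^sub>R a) v = r *\<^sub>R F4_dconn p z a v" for a b v r
    using linear_add[OF linear_F4_dconn, of p z v a b] linear_scale[OF linear_F4_dconn, of p z v r
        a]
    by (simp_all add: F4_dconn_commute[of p z v])
  then have T: "bilinear T"
    unfolding bilinear_def T_def
    by (intro conjI allI linearI;
        simp add: linear_add[OF linD] linear_scale[OF linD] F4_metric_linear_simps
            F4_conn_linear_simps
          F4_curv_def linear_add[OF linear_F4_dconn_base] linear_scale[OF linear_F4_dconn_base]
              algebra_simps)
  have "0 = 2 * F4_metric_explicit p (fst (\<Sum>b\<in>Basis. ?S b (sharp F4_metric p b))) z"
    using harm by (simp add: tension_field_def metric_trace_def F4_metric_linear_simps)
  also have "\<dots> = (\<Sum>b\<in>Basis. 2 * F4_metric_explicit p (fst (?S b (sharp F4_metric p b))) z)"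
    unfolding fst_sum sum_distrib_left[symmetric]
    using bilinear_F4_metric_explicit[of p]
    by (subst linear_sum[of "\<lambda>w. F4_metric_explicit p w z"]) (simp_all add: bilinear_def)
  also have "\<dots> = 2 * (\<Sum>j\<in>UNIV. T (F4_frame j p) (F4_frame j p))"
    unfolding S by (simp add: sum.distrib F4_metric_trace_bilinear[OF p T])
  finally show ?thesis by (simp add: T_def)
qed

section \<open>The horizontal equations in frame components\<close>

definition F4_vec :: "real^4 \<Rightarrow> real \<Rightarrow> real \<Rightarrow> real \<Rightarrow> real \<Rightarrow> real^4" where
  "F4_vec p a b c d = a *\<^sub>R F4_frame 1 p + b *\<^sub>R F4_frame 2 p + c *\<^sub>R F4_frame 3 p
      + d *\<^sub>R F4_frame 4 p"

lemma F4_vec_coframe: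
  "p \<in> F4 \<Longrightarrow> u = F4_vec p (F4_coframe 1 p u) (F4_coframe 2 p u) (F4_coframe 3 p u) (F4_coframe 4 p
      u)"
  using F4_frame_representation[of p u] by (simp add: F4_vec_def sum_4)

lemma F4_coframe_vec:
  assumes "p \<in> F4"
  shows "F4_coframe 1 p (F4_vec p a b c d) = a" "F4_coframe 2 p (F4_vec p a b c d) = b"
    "F4_coframe 3 p (F4_vec p a b c d) = c" "F4_coframe 4 p (F4_vec p a b c d) = d"
  by (simp_all add: F4_vec_def linear_add[OF linear_F4_coframe] linear_scale[OF linear_F4_coframe]
      F4_coframe_frame[OF assms])

lemma F4_vec_nth:
  "F4_vec p a b c d $ 1 = a * sqrt (p $ 4) + b * p $ 3 / sqrt (p $ 4)"
  "F4_vec p a b c d $ 2 = b / sqrt (p $ 4)"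
  "F4_vec p a b c d $ 3 = 2 * p $ 4 * c"
  "F4_vec p a b c d $ 4 = 2 * p $ 4 * d"
  by (simp_all add: F4_vec_def F4_frame_def Let_def axis_def)

lemma F4_vec_alpha: "F4_alpha p (F4_vec p a b c d) = a * sqrt (p $ 4)"
  by (simp add: F4_alpha_def F4_vec_nth)

lemma F4_frame_vec:
  "F4_frame 1 p = F4_vec p 1 0 0 0" "F4_frame 2 p = F4_vec p 0 1 0 0"
  "F4_frame 3 p = F4_vec p 0 0 1 0" "F4_frame 4 p = F4_vec p 0 0 0 1"
  by (simp_all add: F4_vec_def)

lemma F4_curv_swap: "F4_curv p b a v = - F4_curv p a b v"
  by (simp add: F4_curv_def)

text \<open>The coefficients are constant, as are those of the brackets of the frame fields. For
  \<open>Z = a + \<i> b\<close> and \<open>W = c + \<i> d\<close> the operators of the pairs 1, 2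
  and 3, 4 multiply \<open>Z\<close> and \<open>W\<close> by imaginary numbers, and the mixed ones
  send \<open>Z\<close> and \<open>W\<close> to unimodular multiples of \<open>cnj W\<close> and
  \<open>cnj Z\<close>. This is why the equations combine into complex ones.\<close>

lemma F4_curv_frame:
  assumes p: "p \<in> F4"
  shows "F4_curv p (F4_frame 1 p) (F4_frame 2 p) (F4_vec p a b c d)
      = F4_vec p (2 * b) (- 2 * a) (2 * d) (- 2 * c)"
    "F4_curv p (F4_frame 1 p) (F4_frame 3 p) (F4_vec p a b c d) = F4_vec p (- c) d a (- b)"
    "F4_curv p (F4_frame 1 p) (F4_frame 4 p) (F4_vec p a b c d) = F4_vec p (- d) (- c) b a"
    "F4_curv p (F4_frame 2 p) (F4_frame 3 p) (F4_vec p a b c d) = F4_vec p (- d) (- c) b a"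
    "F4_curv p (F4_frame 2 p) (F4_frame 4 p) (F4_vec p a b c d) = F4_vec p c (- d) (- a) b"
    "F4_curv p (F4_frame 3 p) (F4_frame 4 p) (F4_vec p a b c d)
        = F4_vec p (2 * b) (- 2 * a) (- 4 * d) (4 * c)"
proof -
  \<comment> \<open>With \<open>r\<close> in place of \<open>sqrt t\<close> all entries become
    rational functions, which \<open>field_simps\<close> can compare.\<close>
  define r where "r = sqrt (p $ 4)"
  have r: "r > 0" "p $ 4 = r * r" "sqrt (r * r) = r" using p by (simp_all add: r_def F4_def)
  have conn: "F4_conn p (F4_vec p a b c d) (F4_vec p a' b' c' d') = vec4
     (r * (- (c * b' + c' * b) - (d * a' + d' * a)) + p $ 3 * ((- (c * a' + c' * a) + d * b'
         + d' * b) / r))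
     ((- (c * a' + c' * a) + d * b' + d' * b) / r)
     (2 * r * r * (- 2 * (d * c' + c * d') + b * a' + a * b'))
     (2 * r * r * (2 * (c * c' - d * d') + a * a' - b * b'))" for a b c d a' b' c' d'
    using r(1,3) unfolding F4_conn_def F4_conn2_def
    by (simp add: vec_eq_iff forall_4 F4_vec_nth F4_vec_alpha r(2) field_simps power2_eq_square)
  note frame_simps = vec_eq_iff forall_4 conn F4_dconn_def F4_dconn2_def F4_conn_def F4_conn2_def
    F4_vec_nth F4_vec_alpha F4_alpha_def r(2) field_simps power2_eq_square power3_eq_cube
  show "F4_curv p (F4_frame 1 p) (F4_frame 2 p) (F4_vec p a b c d)
      = F4_vec p (2 * b) (- 2 * a) (2 * d) (- 2 * c)"
    using r(1,3) unfolding F4_frame_vec F4_curv_def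
    by (simp add: frame_simps)
  show "F4_curv p (F4_frame 1 p) (F4_frame 3 p) (F4_vec p a b c d) = F4_vec p (- c) d a (- b)"
    using r(1,3) unfolding F4_frame_vec F4_curv_def
    by (simp add: frame_simps)
  show "F4_curv p (F4_frame 1 p) (F4_frame 4 p) (F4_vec p a b c d) = F4_vec p (- d) (- c) b a"
    using r(1,3) unfolding F4_frame_vec F4_curv_def
    by (simp add: frame_simps)
  show "F4_curv p (F4_frame 2 p) (F4_frame 3 p) (F4_vec p a b c d) = F4_vec p (- d) (- c) b a"
    using r(1,3) unfolding F4_frame_vec F4_curv_def
    by (simp add: frame_simps)
  show "F4_curv p (F4_frame 2 p) (F4_frame 4 p) (F4_vec p a b c d) = F4_vec p c (- d) (- a) b"
    using r(1,3) unfolding F4_frame_vec F4_curv_def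
    by (simp add: frame_simps)
  show "F4_curv p (F4_frame 3 p) (F4_frame 4 p) (F4_vec p a b c d)
      = F4_vec p (2 * b) (- 2 * a) (- 4 * d) (4 * c)"
    using r(1,3) unfolding F4_frame_vec F4_curv_def
    by (simp add: frame_simps)
qed

text \<open>\<open>N a\<close> is the covariant derivative of \<open>X\<close>. The subtracted terms
  are the connection one-forms of the frame at \<open>a\<close>, applied to the components of
  \<open>X p\<close>. No \<open>\<theta> 4 a\<close> occurs among them: the frame is parallel along
  its fourth field.\<close>

lemma F4_coframe_covariant:
  assumes p: "p \<in> F4" and X: "(X has_derivative D) (at p)"
  defines "\<theta> \<equiv> \<lambda>i. F4_coframe i p" and "N \<equiv> \<lambda>a. D a + F4_conn p a (X p)"
  shows "((\<lambda>q. F4_coframe 1 q (X q)) has_derivative (\<lambda>a. \<theta> 1 (N a)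
      - (\<theta> 3 a * \<theta> 2 (X p) - \<theta> 2 a * \<theta> 3 (X p) - \<theta> 1 a * \<theta> 4 (X p)))) (at p)"
    "((\<lambda>q. F4_coframe 2 q (X q)) has_derivative (\<lambda>a. \<theta> 2 (N a)
      - (- (\<theta> 3 a * \<theta> 1 (X p)) - \<theta> 1 a * \<theta> 3 (X p) + \<theta> 2 a * \<theta> 4 (X p)))) (at p)"
    "((\<lambda>q. F4_coframe 3 q (X q)) has_derivative (\<lambda>a. \<theta> 3 (N a)
      - (\<theta> 2 a * \<theta> 1 (X p) + \<theta> 1 a * \<theta> 2 (X p) - 2 * \<theta> 3 a * \<theta> 4 (X p)))) (at p)"
    "((\<lambda>q. F4_coframe 4 q (X q)) has_derivative (\<lambda>a. \<theta> 4 (N a)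
      - (\<theta> 1 a * \<theta> 1 (X p) - \<theta> 2 a * \<theta> 2 (X p) + 2 * \<theta> 3 a * \<theta> 3 (X p)))) (at p)"
proof -
  define r where "r = sqrt (p $ 4)"
  have r: "r > 0" "p $ 4 = r * r" "sqrt (r * r) = r" using p by (simp_all add: r_def F4_def)
  have t: "p $ 4 \<noteq> 0" "sqrt (p $ 4) \<noteq> 0" "2 * p $ 4 \<noteq> 0" "0 < p $ 4" using r by simp_all
  have c: "F4_coframe 1 = (\<lambda>q u. F4_alpha q u / sqrt (q $ 4))" "F4_coframe 2
      = (\<lambda>q u. sqrt (q $ 4) * u $ 2)"
    "F4_coframe 3 = (\<lambda>q u. u $ 3 / (2 * q $ 4))" "F4_coframe 4 = (\<lambda>q u. u $ 4 / (2 * q $ 4))"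
    by (simp_all add: F4_coframe_def fun_eq_iff)
  note defs = \<theta>_def N_def F4_conn_def F4_conn2_def F4_alpha_def r(2,3) fun_eq_iff field_simps
      power2_eq_square
  show "((\<lambda>q. F4_coframe 1 q (X q)) has_derivative (\<lambda>a. \<theta> 1 (N a)
      - (\<theta> 3 a * \<theta> 2 (X p) - \<theta> 2 a * \<theta> 3 (X p) - \<theta> 1 a * \<theta> 4 (X p)))) (at p)"
    unfolding c \<theta>_def
    by (rule has_derivative_eq_rhs, (rule derivative_intros has_derivative_vec_nth
        F4_alpha_has_derivative X t | simp)+)
      (use r(1) in \<open>simp add: defs\<close>)
  show "((\<lambda>q. F4_coframe 2 q (X q)) has_derivative (\<lambda>a. \<theta> 2 (N a)
      - (- (\<theta> 3 a * \<theta> 1 (X p)) - \<theta> 1 a * \<theta> 3 (X p) + \<theta> 2 a * \<theta> 4 (X p)))) (at p)"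
    unfolding c \<theta>_def
    by (rule has_derivative_eq_rhs, (rule derivative_intros has_derivative_vec_nth X t | simp)+)
      (use r(1) in \<open>simp add: defs\<close>)
  show "((\<lambda>q. F4_coframe 3 q (X q)) has_derivative (\<lambda>a. \<theta> 3 (N a)
      - (\<theta> 2 a * \<theta> 1 (X p) + \<theta> 1 a * \<theta> 2 (X p) - 2 * \<theta> 3 a * \<theta> 4 (X p)))) (at p)"
    unfolding c \<theta>_def
    by (rule has_derivative_eq_rhs, (rule derivative_intros has_derivative_vec_nth X t | simp)+)
      (use r(1) in \<open>simp add: defs\<close>)
  show "((\<lambda>q. F4_coframe 4 q (X q)) has_derivative (\<lambda>a. \<theta> 4 (N a)
      - (\<theta> 1 a * \<theta> 1 (X p) - \<theta> 2 a * \<theta> 2 (X p) + 2 * \<theta> 3 a * \<theta> 3 (X p)))) (at p)"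
    unfolding c \<theta>_def
    by (rule has_derivative_eq_rhs, (rule derivative_intros has_derivative_vec_nth X t | simp)+)
      (use r(1) in \<open>simp add: defs\<close>)
qed

text \<open>The four equations pair the horizontal part with the four frame vectors.
  \<open>d0\<close> expresses that the components do not vary with \<open>x\<close> and
  \<open>y\<close>. The summands added to the \<open>S i\<close> are connection terms along the
  third frame field; the \<open>T i\<close> receive none.\<close>

lemma harmonic_section_frame_equations:
  fixes X :: "real^4 \<Rightarrow> real^4"
  assumes p: "p \<in> F4"
    and X: "\<And>q. q \<in> F4 \<Longrightarrow> (X has_derivative D q) (at q)"
    and D: "\<And>v. (\<lambda>q. D q v) differentiable (at p)"
    and harm: "tension_field F4_metric (sasaki_metric F4_metric) (\<lambda>p. (p, X p)) p = 0"
    and d: "\<And>i. ((\<lambda>q. F4_coframe i q (X q)) has_derivative d i) (at p)"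
    and d0: "\<And>i. d i (F4_frame 1 p) = 0" "\<And>i. d i (F4_frame 2 p) = 0"
  defines "x \<equiv> \<lambda>i. F4_coframe i p (X p)"
    and "S \<equiv> \<lambda>i. d i (F4_frame 3 p)" and "T \<equiv> \<lambda>i. d i (F4_frame 4 p)"
  shows "(S 1 + x 2) * x 3 - (S 2 - x 1) * x 4 - (S 3 - 2 * x 4) * x 1 + (S 4 + 2 * x 3) * x 2
       + T 1 * x 4 + T 2 * x 3 - T 3 * x 2 - T 4 * x 1 = 0" (is ?E1)
    "(S 1 + x 2) * x 4 + (S 2 - x 1) * x 3 - (S 3 - 2 * x 4) * x 2 - (S 4 + 2 * x 3) * x 1
       - T 1 * x 3 + T 2 * x 4 + T 3 * x 1 - T 4 * x 2 = 0" (is ?E2)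
    "- T 1 * x 2 + T 2 * x 1 + 2 * T 3 * x 4 - 2 * T 4 * x 3 = 0" (is ?E3)
    "(S 1 + x 2) * x 2 - (S 2 - x 1) * x 1 - 2 * (S 3 - 2 * x 4) * x 4 + 2 * (S 4 + 2 * x 3) * x 3
        = 0" (is ?E4)
proof -
  note h = harmonic_section_F4[OF p X D harm]
  define N where "N a = D p a + F4_conn p a (X p)" for a
  have eq: "d 1 = (\<lambda>a. F4_coframe 1 p (N a) - (F4_coframe 3 p a * x 2 - F4_coframe 2 p a * x 3
      - F4_coframe 1 p a * x 4))"
    "d 2 = (\<lambda>a. F4_coframe 2 p (N a) - (- (F4_coframe 3 p a * x 1) - F4_coframe 1 p a * x 3
        + F4_coframe 2 p a * x 4))"
    "d 3 = (\<lambda>a. F4_coframe 3 p (N a) - (F4_coframe 2 p a * x 1 + F4_coframe 1 p a * x 2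
        - 2 * F4_coframe 3 p a * x 4))"
    "d 4 = (\<lambda>a. F4_coframe 4 p (N a) - (F4_coframe 1 p a * x 1 - F4_coframe 2 p a * x 2
        + 2 * F4_coframe 3 p a * x 3))"
    unfolding N_def x_def using F4_coframe_covariant[OF p X[OF p]]
    by (auto intro!: has_derivative_unique[OF d])
  have N: "N a = F4_vec p
      (d 1 a + (F4_coframe 3 p a * x 2 - F4_coframe 2 p a * x 3 - F4_coframe 1 p a * x 4))
      (d 2 a + (- (F4_coframe 3 p a * x 1) - F4_coframe 1 p a * x 3 + F4_coframe 2 p a * x 4))
      (d 3 a + (F4_coframe 2 p a * x 1 + F4_coframe 1 p a * x 2 - 2 * F4_coframe 3 p a * x 4))
      (d 4 a + (F4_coframe 1 p a * x 1 - F4_coframe 2 p a * x 2 + 2 * F4_coframe 3 p a * x 3))"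
          for a
    unfolding eq by (simp add: F4_vec_coframe[OF p, symmetric])
  have Nf: "N (F4_frame 1 p) = F4_vec p (- x 4) (- x 3) (x 2) (x 1)"
      "N (F4_frame 2 p) = F4_vec p (- x 3) (x 4) (x 1) (- x 2)"
      "N (F4_frame 3 p) = F4_vec p (S 1 + x 2) (S 2 - x 1) (S 3 - 2 * x 4) (S 4 + 2 * x 3)"
      "N (F4_frame 4 p) = F4_vec p (T 1) (T 2) (T 3) (T 4)"
    unfolding N by (simp_all add: F4_coframe_frame[OF p] d0 S_def T_def)
  have Xp: "X p = F4_vec p (x 1) (x 2) (x 3) (x 4)"
    unfolding x_def by (rule F4_vec_coframe[OF p])
  have m: "F4_metric_explicit p (F4_vec p a b c e) (F4_vec p a' b' c' e') = a * a' + b * b' + c * c'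
      + e * e'"
    for a b c e a' b' c' e'
    by (simp add: F4_metric_coframe[OF p] F4_coframe_vec[OF p] sum_4)
  have self: "F4_curv p a a v = 0" for a v by (simp add: F4_curv_def)
  have neg: "F4_metric_explicit p u (- v) = - F4_metric_explicit p u v" for u v
    by (simp add: F4_metric_linear_simps)
  have z: "F4_metric_explicit p u 0 = 0" for u by (simp add: F4_metric_linear_simps)
  note swaps = F4_curv_swap[of p "F4_frame 2 p" "F4_frame 1 p"] F4_curv_swap[of p "F4_frame 3 p"
      "F4_frame 1 p"]
    F4_curv_swap[of p "F4_frame 4 p" "F4_frame 1 p"] F4_curv_swap[of p "F4_frame 3 p" "F4_frame 2
        p"]
    F4_curv_swap[of p "F4_frame 4 p" "F4_frame 2 p"] F4_curv_swap[of p "F4_frame 4 p" "F4_frame 3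
        p"]
  have h': "F4_metric_explicit p (N (F4_frame 1 p)) (F4_curv p (F4_frame 1 p) z (X p))
     + F4_metric_explicit p (N (F4_frame 2 p)) (F4_curv p (F4_frame 2 p) z (X p))
     + F4_metric_explicit p (N (F4_frame 3 p)) (F4_curv p (F4_frame 3 p) z (X p))
     + F4_metric_explicit p (N (F4_frame 4 p)) (F4_curv p (F4_frame 4 p) z (X p)) = 0" for z
    using h[of z] by (simp add: sum_4 N_def)
  show ?E1
    using h'[of "F4_frame 1 p"] unfolding self swaps Xp F4_curv_frame[OF p] Nf neg m z
    by (simp add: algebra_simps)
  show ?E2
    using h'[of "F4_frame 2 p"] unfolding self swaps Xp F4_curv_frame[OF p] Nf neg m z
    by (simp add: algebra_simps)
  show ?E3
    using h'[of "F4_frame 3 p"] unfolding self swaps Xp F4_curv_frame[OF p] Nf neg m z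
    by (simp add: algebra_simps)
  show ?E4
    using h'[of "F4_frame 4 p"] unfolding self swaps Xp F4_curv_frame[OF p] Nf neg m z
    by (simp add: algebra_simps)
qed

text \<open>The zero section is totally geodesic: at \<open>v = 0\<close> the map
  \<open>F4_K\<close> vanishes on the image of its differential, so the Sasaki connection there
  reduces to that of the base and the whole second fundamental form is zero, in its vertical part
  too.\<close>

lemma tension_field_zero_section_F4:
  assumes p: "p \<in> F4" and X: "\<And>q. q \<in> F4 \<Longrightarrow> X q = 0"
  shows "tension_field F4_metric (sasaki_metric F4_metric) (\<lambda>p. (p, X p)) p = 0"
proof -
  have dX: "(X has_derivative (\<lambda>_. 0)) (at q)" if "q \<in> F4" for q
    by (rule has_derivative_transform_within_open[OF has_derivative_const open_F4 that]) (simp add: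
        X)
  have dc0: "F4_dconn p a u 0 = 0" for a u by (rule linear_0[OF linear_F4_dconn])
  have "christoffel (sasaki_metric F4_metric) (p, 0) (u, 0) (v, 0) = (F4_conn p u v, 0)" (is "?W
      = _") for u v
  proof (rule prod_eqI)
    have K0: "F4_K (p, 0) (w, 0) = 0" for w by (simp add: F4_K_def F4_conn_linear_simps)
    show "fst ?W = fst (F4_conn p u v, 0)"
    proof (rule F4_metric_eqI[OF p])
      fix z show "F4_metric p (fst ?W) z = F4_metric p (fst (F4_conn p u v, 0)) z"
        using F4_sasaki_christoffel_horizontal[OF p, of 0 "(u, 0)" "(v, 0)" z]
        by (simp add: K0 F4_metric_linear_simps F4_metric_eq[OF p])
    qed
    have "F4_K (p, 0) ?W = 0"
    proof (rule F4_metric_eqI[OF p])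
      fix z show "F4_metric p (F4_K (p, 0) ?W) z = F4_metric p 0 z"
        using F4_sasaki_christoffel[of "(p, 0)" "(u, 0)" "(v, 0)" "(0, z)"] p
        by (simp add: K0 F4_sasaki_def F4_dsasaki_def F4_metric_linear_simps F4_conn_linear_simps
            dc0
            F4_metric_eq[OF p] F4_conn_metric[OF p] F4_K_def)
    qed
    then show "snd ?W = snd (F4_conn p u v, 0)" by (simp add: F4_K_def F4_conn_linear_simps)
  qed
  moreover have "frechet_derivative (\<lambda>q. frechet_derivative (\<lambda>p. (p, X p)) (at q) v) (at p)
      = (\<lambda>_. 0)" for v
  proof -
    have "frechet_derivative (\<lambda>q. frechet_derivative (\<lambda>p. (p, X p)) (at q) v) (at p)
        = frechet_derivative (\<lambda>q. (v, 0 :: real^4)) (at p)"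
      by (rule frechet_cong_open[OF open_F4 p]) (rule section_frechet[OF dX])
    then show ?thesis by simp
  qed
  ultimately have "second_fundamental_form F4_metric (sasaki_metric F4_metric) (\<lambda>p. (p, X p)) p u v
      = 0" for u v
    by (simp add: second_fundamental_form_def section_frechet[OF dX[OF p]] X[OF p]
        F4_christoffel_eq[OF p] zero_prod_def)
  then show ?thesis by (simp add: tension_field_def metric_trace_def)
qed

section \<open>Restriction to the half plane\<close>

definition F4_point :: "complex \<Rightarrow> real^4" where
  "F4_point z = vec4 0 0 (Re z) (Im z)"

lemma F4_point_in_F4: "Im z > 0 \<Longrightarrow> F4_point z \<in> F4"
  by (simp add: F4_def F4_point_def)

lemma F4_point_basis: "F4_point 1 = axis 3 1" "F4_point \<i> = axis 4 1"
  by (simp_all add: F4_point_def vec_eq_iff forall_4 axis_def)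

lemma F4_point_has_derivative: "(F4_point has_derivative F4_point) (at z)"
proof -
  have "linear F4_point"
    by (rule linearI) (simp_all add: F4_point_def vec_eq_iff forall_4)
  then show ?thesis by (simp add: linear_conv_bounded_linear bounded_linear_imp_has_derivative)
qed

lemma continuous_on_F4_point:
  "continuous_on F4 f \<Longrightarrow> continuous_on {z. Im z > 0} (\<lambda>z. f (F4_point z))"
  by (rule continuous_on_compose2[of F4 f])
    (auto simp: F4_point_in_F4 intro!: continuous_at_imp_continuous_on has_derivative_continuous[OF
        F4_point_has_derivative])

lemma C2_complex_F4_component:
  fixes X :: "real^4 \<Rightarrow> real^4"
  assumes "smooth_on F4 X"
  shows "C2_complex {z. Im z > 0} (\<lambda>z. of_real (X (F4_point z) $ k))"
proof -
  define D where "D q = frechet_derivative X (at q)" for q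
  define D2 where "D2 v q = frechet_derivative (\<lambda>q. D q v) (at q)" for v q
  have "Ck_on (Suc (Suc 0)) F4 X" using assms unfolding smooth_on_def by blast
  then have ck: "\<And>q. q \<in> F4 \<Longrightarrow> X differentiable (at q)" "\<And>q v. q \<in> F4
      \<Longrightarrow> (\<lambda>q. D q v) differentiable (at q)"
    and cont: "\<And>u v. continuous_on F4 (\<lambda>q. D2 v q u)"
    unfolding D_def D2_def by auto
  have d: "(X has_derivative D q) (at q)" "((\<lambda>q. D q v) has_derivative D2 v q) (at q)"
      if "q \<in> F4" for q v
    using ck that by (simp_all add: D_def D2_def frechet_derivative_works)
  have pull: "((\<lambda>z. f (F4_point z) $ k) has_derivative (\<lambda>v. f' (F4_point v) $ k)) (at z)"
    if "(f has_derivative f') (at (F4_point z))" for f :: "real^4 \<Rightarrow> real^4" and f' z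
    by (rule has_derivative_vec_nth[OF has_derivative_compose[OF F4_point_has_derivative that]])
  show ?thesis
  proof (rule C2_complex_real[OF open_halfspace_Im_gt])
    fix z :: complex assume "z \<in> {z. Im z > 0}"
    then have z: "F4_point z \<in> F4" by (simp add: F4_point_in_F4)
    show "((\<lambda>z. X (F4_point z) $ k) has_derivative (\<lambda>v. D (F4_point z) (F4_point v) $ k)) (at z)"
      by (rule pull[OF d(1)[OF z]])
    show "((\<lambda>z. D (F4_point z) (F4_point 1) $ k) has_derivative (\<lambda>v. D2 (F4_point 1) (F4_point z)
        (F4_point v) $ k)) (at z)"
      "((\<lambda>z. D (F4_point z) (F4_point \<i>) $ k) has_derivative (\<lambda>v. D2 (F4_point \<i>) (F4_point z)
          (F4_point v) $ k)) (at z)"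
      by (rule pull[OF d(2)[OF z]])+
  qed (intro bounded_linear.continuous_on[OF bounded_linear_vec_nth] continuous_on_F4_point cont)+
qed

lemma C2_complex_cong:
  assumes S: "open S" and "C2_complex S f" and eq: "\<And>z. z \<in> S \<Longrightarrow> f z = g z"
  shows "C2_complex S g"
proof -
  obtain A B A1 A2 B2 where f: "\<And>z. z \<in> S \<Longrightarrow> has_wirtinger f (A z) (B z) z"
    "\<And>z. z \<in> S \<Longrightarrow> has_wirtinger A (A1 z) (A2 z) z" "\<And>z. z \<in> S \<Longrightarrow> has_wirtinger B (A2 z) (B2 z) z"
    using C2_complexE[OF assms(2)] by blast
  have "has_wirtinger g (A z) (B z) z" if "z \<in> S" for z
    using f(1)[OF that] unfolding has_wirtinger_def
    by (rule has_derivative_transform_within_open[OF _ S that eq])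
  then show ?thesis using f(2,3) by (rule C2_complexI)
qed

lemma C2_complex_F4_coframe:
  fixes X :: "real^4 \<Rightarrow> real^4"
  assumes X: "smooth_on F4 X"
  shows "C2_complex {z. Im z > 0} (\<lambda>z. of_real (F4_coframe i (F4_point z) (X (F4_point z))))"
proof -
  note c = C2_complex_add C2_complex_mult C2_complex_const C2_complex_Re C2_complex_Im_powr
    C2_complex_F4_component[OF X]
  have powr_facts: "t powr (- (1 / 2)) = 1 / sqrt t" "t powr (1 / 2) = sqrt t" "t powr (-1) = 1 / t"
    if "t > 0" for t :: real
    using that by (simp_all add: powr_minus_divide powr_half_sqrt)
  let ?x = "\<lambda>k z. of_real (X (F4_point z) $ k) :: complex"
  have "i = 1 \<or> i = 2 \<or> i = 3 \<or> i = 4" by (rule exhaust_4)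
  then show ?thesis
  proof (elim disjE)
    assume i: "i = 1"
    have "C2_complex {z. Im z > 0} (\<lambda>z. (?x 1 z
        + (-1) * (of_real (Re z) * ?x 2 z)) * of_real (Im z powr (- (1/2))))"
      by (intro c)
    then show ?thesis
      by (rule C2_complex_cong[OF open_halfspace_Im_gt])
        (simp only: mem_Collect_eq powr_facts, simp add: i F4_coframe_def F4_alpha_def F4_point_def)
  next
    assume i: "i = 2"
    have "C2_complex {z. Im z > 0} (\<lambda>z. of_real (Im z powr (1/2)) * ?x 2 z)"
      by (intro c)
    then show ?thesis
      by (rule C2_complex_cong[OF open_halfspace_Im_gt])
        (simp only: mem_Collect_eq powr_facts, simp add: i F4_coframe_def F4_point_def)
  next
    assume i: "i = 3"
    have "C2_complex {z. Im z > 0} (\<lambda>z. (1 / 2) * (of_real (Im z powr (-1)) * ?x 3 z))"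
      by (intro c)
    then show ?thesis
      by (rule C2_complex_cong[OF open_halfspace_Im_gt])
        (simp only: mem_Collect_eq powr_facts, simp add: i F4_coframe_def F4_point_def)
  next
    assume i: "i = 4"
    have "C2_complex {z. Im z > 0} (\<lambda>z. (1 / 2) * (of_real (Im z powr (-1)) * ?x 4 z))"
      by (intro c)
    then show ?thesis
      by (rule C2_complex_cong[OF open_halfspace_Im_gt])
        (simp only: mem_Collect_eq powr_facts, simp add: i F4_coframe_def F4_point_def)
  qed
qed

text \<open>\<open>A\<close>, \<open>B\<close> and \<open>C\<close>, \<open>E\<close> are the values
  of \<open>\<partial>\<close> and \<open>dbar\<close> on \<open>Z\<close> and \<open>W\<close>. Up
  to sign and constant factors, the first two real equations are the real and imaginary parts of the
  first complex one, and the last two those of the second. The factors \<open>2 * t\<close> come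
  from the third and fourth frame fields.\<close>

lemma frame_equations_complex_form:
  fixes t x1 x2 x3 x4 s1 s2 s3 s4 t1 t2 t3 t4 :: real
  defines "Z \<equiv> Complex x1 x2" and "W \<equiv> Complex x3 x4"
    and "A \<equiv> Complex ((s1 + t2) / 2) ((s2 - t1) / 2)" and "B \<equiv> Complex ((s1 - t2) / 2) ((s2
        + t1) / 2)"
    and "C \<equiv> Complex ((s3 + t4) / 2) ((s4 - t3) / 2)" and "E \<equiv> Complex ((s3 - t4) / 2) ((s4
        + t3) / 2)"
  assumes e: "(2 * t * s1 + x2) * x3 - (2 * t * s2 - x1) * x4 - (2 * t * s3 - 2 * x4) * x1
      + (2 * t * s4 + 2 * x3) * x2
       + 2 * t * t1 * x4 + 2 * t * t2 * x3 - 2 * t * t3 * x2 - 2 * t * t4 * x1 = 0"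
    "(2 * t * s1 + x2) * x4 + (2 * t * s2 - x1) * x3 - (2 * t * s3 - 2 * x4) * x2 - (2 * t * s4
        + 2 * x3) * x1
       - 2 * t * t1 * x3 + 2 * t * t2 * x4 + 2 * t * t3 * x1 - 2 * t * t4 * x2 = 0"
    "- (2 * t * t1) * x2 + 2 * t * t2 * x1 + 2 * (2 * t * t3) * x4 - 2 * (2 * t * t4) * x3 = 0"
    "(2 * t * s1 + x2) * x2 - (2 * t * s2 - x1) * x1 - 2 * (2 * t * s3 - 2 * x4) * x4
        + 2 * (2 * t * s4 + 2 * x3) * x3 = 0"
  shows "4 * of_real t * (Z * C - W * A) = - 3 * \<i> * Z * W"
    and "4 * of_real t * ((A * cnj Z - Z * cnj B) - 2 * (C * cnj W - W * cnj E))
        = 2 * \<i> * (Z * cnj Z + 4 * (W * cnj W))"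
proof -
  note d = Z_def W_def A_def B_def C_def E_def
  show "4 * of_real t * (Z * C - W * A) = - 3 * \<i> * Z * W"
    using e(1,2) unfolding d by (simp add: complex_eq_iff field_simps)
  show "4 * of_real t * ((A * cnj Z - Z * cnj B) - 2 * (C * cnj W - W * cnj E))
        = 2 * \<i> * (Z * cnj Z + 4 * (W * cnj W))"
  proof (rule complex_eqI)
    show "Re (4 * of_real t * ((A * cnj Z - Z * cnj B) - 2 * (C * cnj W - W * cnj E)))
      = Re (2 * \<i> * (Z * cnj Z + 4 * (W * cnj W)))"
      using e(3) unfolding d by (simp add: field_simps)
    show "Im (4 * of_real t * ((A * cnj Z - Z * cnj B) - 2 * (C * cnj W - W * cnj E)))
      = Im (2 * \<i> * (Z * cnj Z + 4 * (W * cnj W)))"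
      using e(4) unfolding d by (simp add: field_simps)
  qed
qed

theorem theorem4p3:
  fixes X :: "real^4 \<Rightarrow> real^4" and Xc :: "4 \<Rightarrow> real \<Rightarrow> real \<Rightarrow> real"
  assumes "smooth_on F4 X"
    and "\<And>p. p \<in> F4 \<Longrightarrow> X p = (\<Sum>i\<in>UNIV. Xc i (p $ 3) (p $ 4) *\<^sub>R F4_frame i p)"
  shows "harmonic_map_on F4 F4_metric (sasaki_metric F4_metric) (\<lambda>p. (p, X p))
     \<longleftrightarrow> (\<forall>i s t. t > 0 \<longrightarrow> Xc i s t = 0)"
proof
  assume z: "\<forall>i s t. t > 0 \<longrightarrow> Xc i s t = 0"
  have "X q = 0" if "q \<in> F4" for q
    using assms(2)[OF that] z that by (simp add: F4_def)
  then show "harmonic_map_on F4 F4_metric (sasaki_metric F4_metric) (\<lambda>p. (p, X p))"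
    unfolding harmonic_map_on_def using tension_field_zero_section_F4 by blast
next
  assume harm: "harmonic_map_on F4 F4_metric (sasaki_metric F4_metric) (\<lambda>p. (p, X p))"
  define H where "H = {z. Im z > 0}"
  \<comment> \<open>Smoothness is assumed of \<open>X\<close> only. Through the coframe it passes to
    the coefficients \<open>Xc i\<close>, which \<open>g i\<close> equals on
    \<open>F4\<close>.\<close>
  define g where "g i q = F4_coframe i q (X q)" for i q
  have g: "g i q = Xc i (q $ 3) (q $ 4)" if "q \<in> F4" for i q
    unfolding g_def assms(2)[OF that]
    by (simp add: linear_sum[OF linear_F4_coframe] linear_scale[OF linear_F4_coframe]
        F4_coframe_frame[OF that] if_distrib[of "\<lambda>x. _ * x"] cong: if_cong)
  have "Ck_on (Suc (Suc 0)) F4 X" using assms(1) unfolding smooth_on_def by blast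
  then have D: "(X has_derivative frechet_derivative X (at q)) (at q)"
      "\<And>v. (\<lambda>q. frechet_derivative X (at q) v) differentiable (at q)" if "q \<in> F4" for q
    using that by (auto simp: frechet_derivative_works)
  define d where "d i q = frechet_derivative (g i) (at q)" for i q
  have d: "(g i has_derivative d i q) (at q)" if "q \<in> F4" for i q
  proof -
    have "g i differentiable (at q)"
      using exhaust_4[of i] F4_coframe_covariant[OF that D(1)[OF that]]
      unfolding g_def[abs_def] differentiable_def by blast
    then show ?thesis by (simp add: d_def frechet_derivative_works)
  qed
  define f where "f i z = g i (F4_point z)" for i z
  define s where "s i z = d i (F4_point z) (axis 3 1)" for i z
  define \<tau> where "\<tau> i z = d i (F4_point z) (axis 4 1)" for i z
  define a where "a i z = (complex_of_real (s i z) - \<i> * complex_of_real (\<tau> i z)) / 2" for i z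
  define b where "b i z = (complex_of_real (s i z) + \<i> * complex_of_real (\<tau> i z)) / 2" for i z
  have w: "has_wirtinger (\<lambda>z. of_real (f i z)) (a i z) (b i z) z" if "z \<in> H" for i z
  proof -
    have "(f i has_derivative (\<lambda>v. d i (F4_point z) (F4_point v))) (at z)"
      unfolding f_def using that
      by (intro has_derivative_compose[OF F4_point_has_derivative d]) (simp add: H_def
          F4_point_in_F4)
    from has_wirtinger_real[OF this] show ?thesis
      by (simp add: a_def b_def s_def \<tau>_def F4_point_basis)
  qed
  have f: "C2_complex H (\<lambda>z. of_real (f i z))" for i
    unfolding H_def f_def g_def by (rule C2_complex_F4_coframe[OF assms(1)])
  have oH: "open H" unfolding H_def by (rule open_halfspace_Im_gt)
  define Z where "Z z = complex_of_real (f 1 z) + \<i> * of_real (f 2 z)" for z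
  define W where "W z = complex_of_real (f 3 z) + \<i> * of_real (f 4 z)" for z
  define A where "A z = a 1 z + \<i> * a 2 z" for z
  define B where "B z = b 1 z + \<i> * b 2 z" for z
  define C where "C z = a 3 z + \<i> * a 4 z" for z
  define E where "E z = b 3 z + \<i> * b 4 z" for z
  have CZ: "C2_wirtinger H Z A B"
  proof (rule C2_wirtinger_of_C2_complex[OF oH])
    show "C2_complex H Z" unfolding Z_def by (intro C2_complex_add C2_complex_mult C2_complex_const
        f)
    show "has_wirtinger Z (A z) (B z) z" if "z \<in> H" for z
      unfolding Z_def A_def B_def by (intro has_wirtinger_add has_wirtinger_cmult w that)
  qed
  have CW: "C2_wirtinger H W C E"
  proof (rule C2_wirtinger_of_C2_complex[OF oH])
    show "C2_complex H W" unfolding W_def by (intro C2_complex_add C2_complex_mult C2_complex_const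
        f)
    show "has_wirtinger W (C z) (E z) z" if "z \<in> H" for z
      unfolding W_def C_def E_def by (intro has_wirtinger_add has_wirtinger_cmult w that)
  qed
  have eqs: "4 * of_real (Im z) * (Z z * C z - W z * A z) = - 3 * \<i> * Z z * W z"
     "4 * of_real (Im z) * ((A z * cnj (Z z) - Z z * cnj (B z)) - 2 * (C z * cnj (W z)
         - W z * cnj (E z)))
        = 2 * \<i> * (Z z * cnj (Z z) + 4 * (W z * cnj (W z)))" if "z \<in> H" for z
  proof -
    define p where "p = F4_point z"
    have t: "Im z > 0" using that by (simp add: H_def)
    have p: "p \<in> F4" unfolding p_def by (rule F4_point_in_F4[OF t])
    \<comment> \<open>The projection forgets \<open>x\<close> and \<open>y\<close> and fixes
      \<open>p\<close>. As the components depend on \<open>s\<close> and \<open>t\<close> only,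
      \<open>g i\<close> equals its composition with \<open>\<pi>\<close>, so its derivative
      vanishes on the kernel of \<open>\<pi>\<close>.\<close>
    define \<pi> :: "real^4 \<Rightarrow> real^4" where "\<pi> q = vec4 0 0 (q $ 3) (q $ 4)" for q
    have "linear \<pi>" by (rule linearI) (simp_all add: \<pi>_def vec_eq_iff forall_4)
    then have d\<pi>: "(\<pi> has_derivative \<pi>) (at p)"
      by (simp add: linear_conv_bounded_linear bounded_linear_imp_has_derivative)
    have \<pi>p: "\<pi> p = p" by (simp add: \<pi>_def p_def F4_point_def)
    have d0: "d i p v = 0" if "\<pi> v = 0" for i v
    proof -
      have "((\<lambda>q. g i (\<pi> q)) has_derivative (\<lambda>v. d i p (\<pi> v))) (at p)"
        by (rule has_derivative_compose[OF d\<pi>]) (simp add: \<pi>p d[OF p])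
      then have "(g i has_derivative (\<lambda>v. d i p (\<pi> v))) (at p)"
        by (rule has_derivative_transform_within_open[OF _ open_F4 p]) (simp add: g F4_def \<pi>_def)
      then have "d i p = (\<lambda>v. d i p (\<pi> v))" by (rule has_derivative_unique[OF d[OF p]])
      then have "d i p v = d i p 0" using that by metis
      then show ?thesis using linear_0[OF has_derivative_linear[OF d[OF p]]] by simp
    qed
    have fr: "\<pi> (F4_frame 1 p) = 0" "\<pi> (F4_frame 2 p) = 0"
      "F4_frame 3 p = (2 * Im z) *\<^sub>R axis 3 1" "F4_frame 4 p = (2 * Im z) *\<^sub>R axis 4 1"
      by (simp_all add: F4_frame_def Let_def \<pi>_def vec_eq_iff forall_4 axis_def p_def F4_point_def)
    have dfr: "d i p (F4_frame 3 p) = 2 * Im z * s i z" "d i p (F4_frame 4 p)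
        = 2 * Im z * \<tau> i z" for i
      unfolding fr linear_scale[OF has_derivative_linear[OF d[OF p]]]
          by (simp_all add: s_def \<tau>_def p_def)
    have x: "F4_coframe i p (X p) = f i z" for i by (simp add: f_def g_def p_def)
    have h: "tension_field F4_metric (sasaki_metric F4_metric) (\<lambda>p. (p, X p)) p = 0"
      using harm p unfolding harmonic_map_on_def by blast
    note e = harmonic_section_frame_equations[where d = "\<lambda>i. d i p", OF p D(1) D(2)[OF p] h
        d[OF p, unfolded g_def[abs_def]] d0[OF fr(1)] d0[OF fr(2)], unfolded x dfr]
    have c: "Z z = Complex (f 1 z) (f 2 z)" "W z = Complex (f 3 z) (f 4 z)"
      "A z = Complex ((s 1 z + \<tau> 2 z) / 2) ((s 2 z - \<tau> 1 z) / 2)"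
      "B z = Complex ((s 1 z - \<tau> 2 z) / 2) ((s 2 z + \<tau> 1 z) / 2)"
      "C z = Complex ((s 3 z + \<tau> 4 z) / 2) ((s 4 z - \<tau> 3 z) / 2)"
      "E z = Complex ((s 3 z - \<tau> 4 z) / 2) ((s 4 z + \<tau> 3 z) / 2)"
      by (simp_all add: complex_eq_iff Z_def W_def A_def B_def C_def E_def a_def b_def)
    show "4 * of_real (Im z) * (Z z * C z - W z * A z) = - 3 * \<i> * Z z * W z"
      unfolding c by (rule frame_equations_complex_form(1)[OF e])
    show "4 * of_real (Im z) * ((A z * cnj (Z z) - Z z * cnj (B z)) - 2 * (C z * cnj (W z)
        - W z * cnj (E z)))
        = 2 * \<i> * (Z z * cnj (Z z) + 4 * (W z * cnj (W z)))"
      unfolding c by (rule frame_equations_complex_form(2)[OF e])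
  qed
  have f0: "f i z = 0" if "z \<in> H" for i z
  proof -
    have "Z z = 0 \<and> W z = 0"
      by (rule half_plane_pair_vanishes[OF CZ[unfolded H_def] CW[unfolded H_def]])
        (use eqs that in \<open>auto simp: H_def\<close>)
    then show ?thesis using exhaust_4[of i] by (auto simp: Z_def W_def complex_eq_iff)
  qed
  \<comment> \<open>The slice \<open>x = y = 0\<close> meets every pair \<open>s\<close>,
    \<open>t\<close> with \<open>t > 0\<close>, so vanishing there settles the coefficient functions
    everywhere.\<close>
  have "Xc i s t = 0" if "t > 0" for i s t
    using g[OF F4_point_in_F4, of "Complex s t" i] f0[of "Complex s t" i] that
    by (simp add: f_def H_def F4_point_def)
  then show "\<forall>i s t. t > 0 \<longrightarrow> Xc i s t = 0" by blast
qed

end
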